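(* Let $N\ge 2$, let $\Omega\subset\mathbb{R}^N$ be a Lipschitz bounded domain, and let $0<s<1<p<\frac{N}{s}$. Let $\phi_p^s\in W_0^{s,p}(\Omega)$ be the $(s,p)$-torsion function of $\Omega$. Then $$\frac{1}{|\phi_p^s|_1^{p-1}}=\min\left\{[v]_{s,p}^p\,:\,v\in W_0^{s,p}(\Omega),\ |v|_1=1\right\}=\left[\frac{\phi_p^s}{|\phi_p^s|_1}\right]_{s,p}^p .$$ Moreover, $\frac{\phi_p^s}{|\phi_p^s|_1}$ is the only nonnegative function attaining the minimum.
   Context: $|\cdot|_r$ denotes the usual norm of $L^r(\Omega)$, $1\le r\le\infty$. For a measurable function $u:\mathbb{R}^N\to\mathbb{R}$, the Gagliardo seminorm is $[u]_{s,p}:=\left(\int_{\mathbb{R}^N}\int_{\mathbb{R}^N}\frac{|u(x)-u(y)|^p}{|x-y|^{N+sp}}\,dx\,dy\right)^{1/p}$. The space $W_0^{s,p}(\Omega)$ is the closure of $C_0^\infty(\Omega)$ with respect to the norm $\|u\|:=[u]_{s,p}+|u|_p$; its elements are regarded as functions on $\mathbb{R}^N$ vanishing in $\mathbb{R}^N\setminus\Omega$. For $u,\varphi\in W_0^{s,p}(\Omega)$ put $$\langle(-\Delta)_p^s u,\varphi\rangle:=\int_{\mathbb{R}^N}\int_{\mathbb{R}^N}\frac{|u(x)-u(y)|^{p-2}(u(x)-u(y))(\varphi(x)-\varphi(y))}{|x-y|^{N+sp}}\,dx\,dy .$$ The $(s,p)$-torsion function $\phi_p^s$ of $\Omega$ is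 the unique weak solution of $(-\Delta)_p^s u=1$ in $\Omega$, $u=0$ in $\mathbb{R}^N\setminus\Omega$, i.e. the unique function $\phi_p^s\in W_0^{s,p}(\Omega)$ with $\langle(-\Delta)_p^s\phi_p^s,\varphi\rangle=\int_\Omega\varphi\,dx$ for all $\varphi\in W_0^{s,p}(\Omega)$; it satisfies $\phi_p^s\ge 0$. *)

theory Defs
  imports "HOL-Analysis.Analysis"
begin

text \<open>
  A bounded domain is Lipschitz if, near each boundary point and up to a rotation of the axes, it
  is the part of a ball above the graph of a Lipschitz function. Here \<open>e\<close> is the vertical direction
  and the graph lives over the hyperplane orthogonal to \<open>e\<close>.
\<close>

definition lipschitz_bounded_domain :: "'a::euclidean_space set \<Rightarrow> bool" where
  "lipschitz_bounded_domain \<Omega> \<longleftrightarrow>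
     open \<Omega> \<and> connected \<Omega> \<and> \<Omega> \<noteq> {} \<and> bounded \<Omega> \<and>
     (\<forall>z\<in>frontier \<Omega>. \<exists>r>0. \<exists>e g L. norm e = 1 \<and> L-lipschitz_on {y. y \<bullet> e = 0} g \<and>
        \<Omega> \<inter> ball z r = {x \<in> ball z r. (g (x - (x \<bullet> e) *\<^sub>R e) :: real) < x \<bullet> e})"

fun C_k :: "nat \<Rightarrow> ('a::euclidean_space \<Rightarrow> real) \<Rightarrow> bool" where
  "C_k 0 f \<longleftrightarrow> continuous_on UNIV f"
| "C_k (Suc k) f \<longleftrightarrow>
     (\<forall>x. f differentiable at x) \<and> (\<forall>b\<in>Basis. C_k k (\<lambda>x. frechet_derivative f (at x) b))"

definition test_functions :: "'a::euclidean_space set \<Rightarrow> ('a \<Rightarrow> real) set" where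
  "test_functions \<Omega> =
     {f. (\<forall>k. C_k k f) \<and> compact (closure {x. f x \<noteq> 0}) \<and> closure {x. f x \<noteq> 0} \<subseteq> \<Omega>}"

definition L_norm :: "'a::euclidean_space set \<Rightarrow> real \<Rightarrow> ('a \<Rightarrow> real) \<Rightarrow> real" where
  "L_norm \<Omega> r u = (LINT x:\<Omega>|lebesgue. \<bar>u x\<bar> powr r) powr (1 / r)"

definition gagliardo_integrand ::
  "real \<Rightarrow> real \<Rightarrow> ('a::euclidean_space \<Rightarrow> real) \<Rightarrow> 'a \<times> 'a \<Rightarrow> real" where
  "gagliardo_integrand s p u =
     (\<lambda>(x, y). \<bar>u x - u y\<bar> powr p / norm (x - y) powr (real DIM('a) + s * p))"

text \<open>
  The Bochner integral of a non-integrable function is \<open>0\<close>, so \<open>L_norm\<close> and \<open>gagliardo\<close> have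
  their intended meaning only where the integrals are finite; the space \<open>W\<close> below imposes this.
\<close>

definition gagliardo :: "real \<Rightarrow> real \<Rightarrow> ('a::euclidean_space \<Rightarrow> real) \<Rightarrow> real" where
  "gagliardo s p u =
     integral\<^sup>L (lebesgue \<Otimes>\<^sub>M lebesgue) (gagliardo_integrand s p u) powr (1 / p)"

text \<open>
  The spaces consist of representatives: both are closed under changes on null sets, and equality
  of their elements means equality almost everywhere. \<open>W0\<close> is the closure of the test functions
  inside the space \<open>W\<close> of all functions of finite norm that vanish outside \<open>\<Omega>\<close>.
\<close>

definition W :: "real \<Rightarrow> real \<Rightarrow> 'a::euclidean_space set \<Rightarrow> ('a \<Rightarrow> real) set" where
  "W s p \<Omega> = {u. u \<in> borel_measurable lebesgue \<and> (AE x in lebesgue. x \<notin> \<Omega> \<longrightarrow> u x = 0) \<and>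
     set_integrable lebesgue \<Omega> (\<lambda>x. \<bar>u x\<bar> powr p) \<and>
     integrable (lebesgue \<Otimes>\<^sub>M lebesgue) (gagliardo_integrand s p u)}"

definition W0 :: "real \<Rightarrow> real \<Rightarrow> 'a::euclidean_space set \<Rightarrow> ('a \<Rightarrow> real) set" where
  "W0 s p \<Omega> = {u \<in> W s p \<Omega>. \<forall>\<epsilon>>0. \<exists>f\<in>test_functions \<Omega>.
     gagliardo s p (\<lambda>x. u x - f x) + L_norm \<Omega> p (\<lambda>x. u x - f x) < \<epsilon>}"

definition frac_p_laplacian ::
  "real \<Rightarrow> real \<Rightarrow> ('a::euclidean_space \<Rightarrow> real) \<Rightarrow> ('a \<Rightarrow> real) \<Rightarrow> real" where
  "frac_p_laplacian s p u v =
     (LINT (x, y)|(lebesgue \<Otimes>\<^sub>M lebesgue).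
        \<bar>u x - u y\<bar> powr (p - 2) * (u x - u y) * (v x - v y)
          / norm (x - y) powr (real DIM('a) + s * p))"

definition is_torsion_function ::
  "real \<Rightarrow> real \<Rightarrow> 'a::euclidean_space set \<Rightarrow> ('a \<Rightarrow> real) \<Rightarrow> bool" where
  "is_torsion_function s p \<Omega> \<phi> \<longleftrightarrow> \<phi> \<in> W0 s p \<Omega> \<and>
     (\<forall>v\<in>W0 s p \<Omega>. frac_p_laplacian s p \<phi> v = (LINT x:\<Omega>|lebesgue. v x))"

end

theory Submission
  imports Defs
begin

text \<open>
  Write \<open>E v\<close> for the \<open>p\<close>-th power of the Gagliardo seminorm, \<open>A u v\<close> for the weak form of the
  fractional \<open>p\<close>-Laplacian and \<open>T\<close> for the \<open>L\<^sup>1\<close> norm of the torsion function \<open>\<phi>\<close>. Everything follows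
  from Young's inequality in the form
  \<open>\<bar>a\<bar>\<^sup>p\<^sup>-\<^sup>2 a b \<le> (1 - 1/p) \<bar>a\<bar>\<^sup>p + (1/p) \<bar>b\<bar>\<^sup>p\<close>, with equality only for \<open>a = b\<close> (\<open>powr_young\<close>).
  Applied to increments and integrated it gives \<open>A \<phi> v \<le> (1 - 1/p) E \<phi> + (1/p) E v\<close>, and the
  left side is \<open>\<integral> v\<close> for a torsion function.

  The main step (\<open>torsion_bound\<close>) improves the left side to \<open>\<integral> \<bar>v\<bar>\<close>. Replacing \<open>v\<close> by its absolute
  value does not increase the energy, but it leaves the class of smooth functions by whose closure
  the space is defined. So \<open>v\<close> is approximated by a test function \<open>f\<close>, and \<open>\<bar>f\<bar>\<close> by
  \<open>sqrt (f\<^sup>2 + \<epsilon>\<^sup>2) - \<epsilon>\<close>, which is again a test function, is a contraction of \<open>f\<close> and hence has no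
  larger energy, and differs from \<open>\<bar>f\<bar>\<close> by at most \<open>\<epsilon>\<close>.

  Three consequences finish the proof. For \<open>v = \<phi>\<close>, where \<open>E \<phi> = A \<phi> \<phi> = \<integral> \<phi>\<close>, the bound reads
  \<open>\<integral> \<bar>\<phi>\<bar> \<le> \<integral> \<phi>\<close>, so \<open>\<phi> \<ge> 0\<close> and \<open>E \<phi> = T\<close>. For \<open>T v\<close> with \<open>\<integral> \<bar>v\<bar> = 1\<close> it reads
  \<open>T \<le> (1 - 1/p) T + (1/p) T\<^sup>p E v\<close>, that is \<open>E v \<ge> T\<^sup>1\<^sup>-\<^sup>p\<close>, and by homogeneity \<open>\<phi> / T\<close> attains this
  value. If a nonnegative \<open>v\<close> attains it too, then the integrated Young inequality for \<open>\<phi>\<close> and \<open>T v\<close>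
  is an equality, so the two functions have the same increments almost everywhere; they differ
  by a constant, which is \<open>0\<close> because both vanish outside the bounded set \<open>\<Omega>\<close>.

  Two facts about test functions support this. There is a nonzero nonnegative one, whence
  \<open>T > 0\<close>. And each has finite energy, whence the seminorms by which elements of
  the space are approximated are genuine integrals, not the default value \<open>0\<close> of a divergent one.
\<close>

section \<open>Inequalities for powers\<close>

text \<open>
  The strictly convex function \<open>t\<^sup>p\<close> lies above its tangent at \<open>1\<close> and touches it only there. By the
  mean value theorem the secant slope between \<open>1\<close> and \<open>t\<close> is \<open>p z\<^sup>p\<^sup>-\<^sup>1\<close> for some \<open>z\<close> strictly in
  between, which is above \<open>p\<close> for \<open>t > 1\<close> and below \<open>p\<close> for \<open>t < 1\<close>.
\<close>

lemma powr_ge_tangent: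
  fixes p t :: real
  assumes p: "1 < p" and t: "0 \<le> t"
  shows "1 + p * (t - 1) \<le> t powr p" and "t powr p = 1 + p * (t - 1) \<Longrightarrow> t = 1"
proof -
  have strict: "1 + p * (t - 1) < t powr p" if "t \<noteq> 1"
  proof (cases "t = 0")
    case True
    then show ?thesis using p by simp
  next
    case False
    with t have "0 < t" by simp
    have der: "((\<lambda>z. z powr p) has_real_derivative p * x powr (p - 1)) (at x)" if "0 < x" for x :: real
      using that by (rule has_real_derivative_powr)
    show ?thesis
    proof (cases "t < 1")
      case True
      obtain z where z: "t < z" "z < 1" and eq: "1 powr p - t powr p = (1 - t) * (p * z powr (p - 1))"
        using MVT2[OF True, of "\<lambda>z. z powr p" "\<lambda>z. p * z powr (p - 1)"] der \<open>0 < t\<close> by auto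
      have "z powr (p - 1) < 1"
        using z \<open>0 < t\<close> p powr_less_mono2[of "p - 1" z 1] by simp
      then have "(1 - t) * (p * z powr (p - 1)) < (1 - t) * (p * 1)"
        using True p by (intro mult_strict_left_mono) auto
      with eq show ?thesis by (simp add: algebra_simps)
    next
      case False
      with \<open>t \<noteq> 1\<close> have "1 < t" by simp
      obtain z where z: "1 < z" "z < t" and eq: "t powr p - 1 powr p = (t - 1) * (p * z powr (p - 1))"
        using MVT2[OF \<open>1 < t\<close>, of "\<lambda>z. z powr p" "\<lambda>z. p * z powr (p - 1)"] der by auto
      have "1 < z powr (p - 1)"
        using z p powr_less_mono2[of "p - 1" 1 z] by simp
      then have "(t - 1) * (p * 1) < (t - 1) * (p * z powr (p - 1))"
        using \<open>1 < t\<close> p by (intro mult_strict_left_mono) auto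
      with eq show ?thesis by (simp add: algebra_simps)
    qed
  qed
  show "1 + p * (t - 1) \<le> t powr p" using strict by (cases "t = 1") auto
  show "t = 1" if "t powr p = 1 + p * (t - 1)" using strict that by force
qed

lemma abs_powr_minus_two_mult:
  fixes a :: real
  shows "\<bar>a\<bar> powr (p - 2) * a * a = \<bar>a\<bar> powr p"
proof (cases "a = 0")
  case False
  have "\<bar>a\<bar> powr (p - 2) * a * a = \<bar>a\<bar> powr (p - 2) * \<bar>a\<bar> powr 2"
    using False by (simp add: power2_eq_square)
  also have "\<dots> = \<bar>a\<bar> powr p" by (subst powr_add[symmetric]) simp
  finally show ?thesis .
qed simp

text \<open>
  After division by \<open>\<bar>a\<bar>\<^sup>p\<close> the difference of the two sides is the gap in \<open>powr_ge_tangent\<close> at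
  \<open>t = \<bar>b / a\<bar>\<close>, divided by \<open>p\<close>, plus \<open>t - b / a\<close>. Both terms are nonnegative; the first vanishes only
  for \<open>t = 1\<close> and the second only if \<open>a\<close> and \<open>b\<close> have the same sign.
\<close>

lemma powr_young:
  fixes p a b :: real
  assumes p: "1 < p"
  shows "\<bar>a\<bar> powr (p - 2) * a * b \<le> (1 - 1 / p) * \<bar>a\<bar> powr p + 1 / p * \<bar>b\<bar> powr p"
    and "\<bar>a\<bar> powr (p - 2) * a * b = (1 - 1 / p) * \<bar>a\<bar> powr p + 1 / p * \<bar>b\<bar> powr p \<Longrightarrow> a = b"
proof -
  have *: "\<bar>a\<bar> powr (p - 2) * a * b \<le> (1 - 1 / p) * \<bar>a\<bar> powr p + 1 / p * \<bar>b\<bar> powr p \<and>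
    (\<bar>a\<bar> powr (p - 2) * a * b = (1 - 1 / p) * \<bar>a\<bar> powr p + 1 / p * \<bar>b\<bar> powr p \<longrightarrow> a = b)"
  proof (cases "a = 0")
    case True
    then show ?thesis using p by simp
  next
    case False
    define t where "t = \<bar>b / a\<bar>"
    have A: "0 < \<bar>a\<bar> powr p" using False by simp
    have b: "\<bar>b\<bar> powr p = \<bar>a\<bar> powr p * t powr p"
      using False by (simp add: t_def abs_divide powr_divide)
    have ba: "b / a \<le> t" unfolding t_def by (rule abs_ge_self)
    have ab: "\<bar>a\<bar> powr (p - 2) * a * b = \<bar>a\<bar> powr p * (b / a)"
      using False by (simp flip: abs_powr_minus_two_mult[of a p])
    have gap: "(1 - 1 / p) * \<bar>a\<bar> powr p + 1 / p * \<bar>b\<bar> powr p - \<bar>a\<bar> powr (p - 2) * a * b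
        = \<bar>a\<bar> powr p * ((t powr p - (1 + p * (t - 1))) / p + (t - b / a))"
      unfolding ab b using p False by (simp add: field_simps)
    have t0: "0 \<le> t" by (simp add: t_def)
    have t1: "1 + p * (t - 1) \<le> t powr p"
      using p t0 by (rule powr_ge_tangent(1))
    have nn: "0 \<le> (t powr p - (1 + p * (t - 1))) / p" using t1 p by simp
    have "0 \<le> \<bar>a\<bar> powr p * ((t powr p - (1 + p * (t - 1))) / p + (t - b / a))"
      using nn ba A by (intro mult_nonneg_nonneg) auto
    moreover have "a = b" if "(1 - 1 / p) * \<bar>a\<bar> powr p + 1 / p * \<bar>b\<bar> powr p = \<bar>a\<bar> powr (p - 2) * a * b"
    proof -
      have "(t powr p - (1 + p * (t - 1))) / p + (t - b / a) = 0"
        using gap that A by simp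
      then have "(t powr p - (1 + p * (t - 1))) / p = 0" and t: "t = b / a" using nn ba by linarith+
      then have "t powr p = 1 + p * (t - 1)" using p by simp
      then have "t = 1" using powr_ge_tangent(2)[OF p t0] by simp
      with t False show "a = b" by simp
    qed
    ultimately show ?thesis using gap by force
  qed
  show "\<bar>a\<bar> powr (p - 2) * a * b \<le> (1 - 1 / p) * \<bar>a\<bar> powr p + 1 / p * \<bar>b\<bar> powr p"
    using * by blast
  show "\<bar>a\<bar> powr (p - 2) * a * b = (1 - 1 / p) * \<bar>a\<bar> powr p + 1 / p * \<bar>b\<bar> powr p \<Longrightarrow> a = b"
    using * by blast
qed

lemma abs_powr_young:
  fixes p a b :: real
  assumes p: "1 < p"
  shows "\<bar>\<bar>a\<bar> powr (p - 2) * a * b\<bar> \<le> \<bar>a\<bar> powr p + \<bar>b\<bar> powr p"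
proof -
  have "\<bar>\<bar>a\<bar> powr (p - 2) * a * b\<bar> = \<bar>\<bar>a\<bar>\<bar> powr (p - 2) * \<bar>a\<bar> * \<bar>b\<bar>" by (simp add: abs_mult)
  also have "\<dots> \<le> (1 - 1 / p) * \<bar>a\<bar> powr p + 1 / p * \<bar>b\<bar> powr p"
    using powr_young(1)[OF p, of "\<bar>a\<bar>" "\<bar>b\<bar>"] by simp
  also have "\<dots> \<le> 1 * \<bar>a\<bar> powr p + 1 * \<bar>b\<bar> powr p"
    using p by (intro add_mono mult_right_mono) auto
  finally show ?thesis by simp
qed

text \<open>
  Convexity of \<open>\<bar>x\<bar>\<^sup>p\<close> at \<open>a + b = (1 - \<delta>) (a / (1 - \<delta>)) + \<delta> (b / \<delta>)\<close>. As \<open>\<delta>\<close> tends to \<open>0\<close> the factor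
  of \<open>\<bar>a\<bar>\<^sup>p\<close> tends to \<open>1\<close>, so this does the work of Minkowski's inequality when \<open>b\<close> is a small error.
\<close>

lemma abs_add_powr_le:
  fixes p a b \<delta> :: real
  assumes p: "1 < p" and \<delta>: "0 < \<delta>" "\<delta> < 1"
  shows "\<bar>a + b\<bar> powr p \<le> (1 - \<delta>) powr (1 - p) * \<bar>a\<bar> powr p + \<delta> powr (1 - p) * \<bar>b\<bar> powr p"
proof -
  define c where "c = a + b"
  define k where "k = \<bar>c\<bar> powr (p - 2) * c"
  \<comment> \<open>Young's inequality, read as the supporting line of \<open>\<bar>y\<bar>\<^sup>p\<close> at \<open>c\<close>.\<close>
  have tang: "p * (k * y) \<le> (p - 1) * \<bar>c\<bar> powr p + \<bar>y\<bar> powr p" for y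
  proof -
    have "p * (k * y) \<le> p * ((1 - 1 / p) * \<bar>c\<bar> powr p + 1 / p * \<bar>y\<bar> powr p)"
      using powr_young(1)[OF p, of c y] p unfolding k_def by (intro mult_left_mono) auto
    also have "\<dots> = (p - 1) * \<bar>c\<bar> powr p + \<bar>y\<bar> powr p" using p by (simp add: field_simps)
    finally show ?thesis .
  qed
  have scale: "\<tau> * \<bar>x / \<tau>\<bar> powr p = \<tau> powr (1 - p) * \<bar>x\<bar> powr p" if "0 < \<tau>" for x \<tau> :: real
    using that by (simp add: powr_divide powr_diff abs_divide)
  have "p * (k * a) \<le> (1 - \<delta>) * ((p - 1) * \<bar>c\<bar> powr p) + (1 - \<delta>) powr (1 - p) * \<bar>a\<bar> powr p"
    using mult_left_mono[OF tang[of "a / (1 - \<delta>)"], of "1 - \<delta>"] \<delta> scale[of "1 - \<delta>" a]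
    by (simp add: distrib_left)
  moreover have "p * (k * b) \<le> \<delta> * ((p - 1) * \<bar>c\<bar> powr p) + \<delta> powr (1 - p) * \<bar>b\<bar> powr p"
    using mult_left_mono[OF tang[of "b / \<delta>"], of \<delta>] \<delta> scale[of \<delta> b]
    by (simp add: distrib_left)
  moreover have "p * (k * a) + p * (k * b) = p * \<bar>c\<bar> powr p"
  proof -
    have "p * (k * a) + p * (k * b) = p * (k * c)" by (simp add: c_def distrib_left)
    also have "k * c = \<bar>c\<bar> powr p" unfolding k_def by (rule abs_powr_minus_two_mult)
    finally show ?thesis .
  qed
  ultimately show ?thesis unfolding c_def[symmetric] by (simp add: algebra_simps)
qed

text \<open>
  On a set of finite measure this controls the \<open>L\<^sup>1\<close> norm of an error by its \<open>L\<^sup>p\<close> norm, up to an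
  arbitrarily small constant.
\<close>

lemma abs_le_add_powr:
  fixes p a \<delta> :: real
  assumes p: "1 < p" and \<delta>: "0 < \<delta>"
  shows "\<bar>a\<bar> \<le> \<delta> + \<delta> powr (1 - p) * \<bar>a\<bar> powr p"
proof (cases "\<bar>a\<bar> \<le> \<delta>")
  case False
  then have "\<bar>a\<bar> powr (1 - p) \<le> \<delta> powr (1 - p)"
    using p \<delta> by (intro powr_mono2') auto
  then have "\<bar>a\<bar> powr (1 - p) * \<bar>a\<bar> powr p \<le> \<delta> powr (1 - p) * \<bar>a\<bar> powr p"
    by (rule mult_right_mono) simp
  then show ?thesis using \<delta> by (simp flip: powr_add)
qed (use \<delta> in \<open>auto intro: add_increasing2\<close>)

text \<open>
  The triangle inequality in the plane for the points \<open>(s, e)\<close> and \<open>(t, e)\<close>.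
\<close>

lemma abs_sqrt_sum_squares_diff_le:
  fixes s t e :: real
  shows "\<bar>sqrt (s\<^sup>2 + e\<^sup>2) - sqrt (t\<^sup>2 + e\<^sup>2)\<bar> \<le> \<bar>s - t\<bar>"
  using real_sqrt_sum_squares_triangle_ineq[of s "t - s" e 0]
    real_sqrt_sum_squares_triangle_ineq[of t "s - t" e 0]
  by (simp add: abs_minus_commute)

section \<open>Smooth functions\<close>

lemma C_k_SucI:
  assumes "\<And>x. (f has_derivative D x) (at x)" "\<And>b. b \<in> Basis \<Longrightarrow> C_k k (\<lambda>x. D x b)"
  shows "C_k (Suc k) f"
proof -
  have "D x = frechet_derivative f (at x)" for x
    using assms(1) by (rule frechet_derivative_at)
  then show ?thesis using assms by (auto intro: differentiableI)
qed

lemma C_k_Suc_has_derivative: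
  "C_k (Suc k) f \<Longrightarrow> (f has_derivative frechet_derivative f (at x)) (at x)"
  by (simp add: frechet_derivative_works)

lemma C_k_Suc_imp_C_k: "C_k (Suc k) f \<Longrightarrow> C_k k f"
proof (induction k arbitrary: f)
  case 0
  then show ?case by (auto intro!: continuous_at_imp_continuous_on differentiable_imp_continuous_within)
next
  case (Suc k)
  then show ?case using C_k.simps(2)[of k f] C_k.simps(2)[of "Suc k" f] by blast
qed

lemma C_k_const [intro]: "C_k k (\<lambda>x. c)"
  by (induction k arbitrary: c) (auto intro: C_k_SucI[where D = "\<lambda>_ _. 0"] simp del: C_k.simps(2))

lemma C_k_add [intro]: "C_k k f \<Longrightarrow> C_k k g \<Longrightarrow> C_k k (\<lambda>x. f x + g x)"
proof (induction k arbitrary: f g)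
  case 0
  then show ?case by (simp add: continuous_on_add)
next
  case (Suc k)
  show ?case
    by (rule C_k_SucI[OF has_derivative_add[OF C_k_Suc_has_derivative[OF Suc.prems(1)]
          C_k_Suc_has_derivative[OF Suc.prems(2)]]]) (use Suc in auto)
qed

lemma C_k_mult [intro]: "C_k k f \<Longrightarrow> C_k k g \<Longrightarrow> C_k k (\<lambda>x. f x * g x)"
proof (induction k arbitrary: f g)
  case 0
  then show ?case by (simp add: continuous_on_mult)
next
  case (Suc k)
  show ?case
  proof (rule C_k_SucI[OF has_derivative_mult[OF C_k_Suc_has_derivative[OF Suc.prems(1)]
          C_k_Suc_has_derivative[OF Suc.prems(2)]]])
    fix b :: 'a assume "b \<in> Basis"
    then show "C_k k (\<lambda>x. f x * frechet_derivative g (at x) b + frechet_derivative f (at x) b * g x)"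
      using Suc C_k_Suc_imp_C_k[OF Suc.prems(1)] C_k_Suc_imp_C_k[OF Suc.prems(2)]
      by (intro C_k_add Suc.IH) auto
  qed
qed

lemma C_k_sum [intro]: "(\<And>i. i \<in> I \<Longrightarrow> C_k k (f i)) \<Longrightarrow> C_k k (\<lambda>x. \<Sum>i\<in>I. f i x)"
  by (induction I rule: infinite_finite_induct) auto

lemma C_k_inner [intro]: "C_k k (\<lambda>x. x \<bullet> b)"
proof (cases k)
  case 0
  then show ?thesis by (simp add: continuous_on_inner)
next
  case (Suc m)
  show ?thesis unfolding Suc
    by (rule C_k_SucI[where D = "\<lambda>_ x. x \<bullet> b"]) (auto intro!: derivative_eq_intros)
qed

text \<open>
  Smoothness of \<open>h\<^sub>i \<circ> f\<close> for a whole family of outer functions at once: if every derivative of a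
  member is a combination of two members, then the induction on \<open>k\<close> stays inside the family. Both powers
  and the functions \<open>flat_exp\<close> below have this form.
\<close>

lemma C_k_compose:
  fixes h :: "'i \<Rightarrow> real \<Rightarrow> real"
  assumes der: "\<And>i. \<exists>c d j l. \<forall>t\<in>D. (h i has_real_derivative c * h j t + d * h l t) (at t)"
    and f: "C_k k f" "\<And>x. f x \<in> D"
  shows "C_k k (\<lambda>x. h i (f x))"
  using f(1)
proof (induction k arbitrary: i)
  case 0
  have "isCont (\<lambda>x. h i (f x)) x" for x
  proof (rule isCont_o2[where f = f and g = "h i"])
    show "isCont f x" using 0 by (simp add: continuous_on_eq_continuous_at)
    show "isCont (h i) (f x)" using der[of i] f(2) DERIV_isCont by blast
  qed
  then show ?case by (simp add: continuous_at_imp_continuous_on)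
next
  case (Suc k)
  obtain c d j l where *: "\<And>t. t \<in> D \<Longrightarrow> (h i has_real_derivative c * h j t + d * h l t) (at t)"
    using der[of i] by blast
  have f': "C_k k f" using Suc.prems by (rule C_k_Suc_imp_C_k)
  show ?case
  proof (rule C_k_SucI)
    fix x
    have "(h i has_derivative (\<lambda>y. (c * h j (f x) + d * h l (f x)) * y)) (at (f x))"
      using * f(2) by (simp add: has_field_derivative_def)
    from has_derivative_compose[OF C_k_Suc_has_derivative[OF Suc.prems] this]
    show "((\<lambda>x. h i (f x)) has_derivative
      (\<lambda>y. (c * h j (f x) + d * h l (f x)) * frechet_derivative f (at x) y)) (at x)" .
  next
    fix b :: 'a assume b: "b \<in> Basis"
    have "C_k k (\<lambda>x. c * h j (f x) + d * h l (f x))"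
      using Suc.IH f' by (intro C_k_add C_k_mult C_k_const) auto
    moreover have "C_k k (\<lambda>x. frechet_derivative f (at x) b)" using Suc.prems b by auto
    ultimately show "C_k k (\<lambda>x. (c * h j (f x) + d * h l (f x)) * frechet_derivative f (at x) b)"
      by (rule C_k_mult)
  qed
qed

lemma C_k_powr:
  assumes "C_k k f" "\<And>x. 0 < f x"
  shows "C_k k (\<lambda>x. f x powr a)"
proof (rule C_k_compose[where h = "\<lambda>a t. t powr a" and D = "{0<..}"])
  fix a :: real
  show "\<exists>c d j l. \<forall>t\<in>{0<..}. ((\<lambda>t. t powr a) has_real_derivative c * t powr j + d * t powr l) (at t)"
    by (rule exI[of _ a], rule exI[of _ 0], rule exI[of _ "a - 1"], rule exI[of _ 0])
      (auto intro: has_real_derivative_powr)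
qed (use assms in auto)

text \<open>
  All derivatives of the standard flat function, the case \<open>m = 0\<close>, are linear combinations of members
  of this family.
\<close>

definition flat_exp :: "nat \<Rightarrow> real \<Rightarrow> real" where
  "flat_exp m t = (if 0 < t then exp (- inverse t) * inverse t ^ m else 0)"

lemma tendsto_flat_exp: "((\<lambda>t. exp (- inverse t) * inverse t ^ m) \<longlongrightarrow> 0) (at_right (0::real))"
proof -
  have "((\<lambda>y::real. y ^ m / exp y) \<longlongrightarrow> 0) at_top" by (rule tendsto_power_div_exp_0)
  then have "((\<lambda>t. inverse t ^ m / exp (inverse t)) \<longlongrightarrow> 0) (at_right (0::real))"
    by (rule filterlim_compose) (rule filterlim_inverse_at_top_right)
  then show ?thesis by (simp add: exp_minus divide_inverse mult.commute)
qed

text \<open>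
  At \<open>0\<close> the difference quotient of the \<open>m\<close>-th function is the \<open>(m + 1)\<close>-st function, which tends to
  \<open>0\<close> because the exponential beats every power.
\<close>

lemma flat_exp_has_derivative:
  "(flat_exp m has_real_derivative - real m * flat_exp (Suc m) t + 1 * flat_exp (m + 2) t) (at t)"
proof (cases t "0::real" rule: linorder_cases)
  case less
  have "((\<lambda>t. 0) has_real_derivative - real m * flat_exp (Suc m) t + 1 * flat_exp (m + 2) t) (at t)"
    using less by (simp add: flat_exp_def)
  then show ?thesis
    by (rule has_field_derivative_transform_within_open[of _ _ _ "{..<0}"])
      (use less in \<open>auto simp: flat_exp_def\<close>)
next
  case greater
  have "((\<lambda>t. exp (- inverse t) * inverse t ^ m) has_real_derivative
      - real m * flat_exp (Suc m) t + 1 * flat_exp (m + 2) t) (at t)"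
    using greater
    by (cases m) (auto intro!: derivative_eq_intros simp: flat_exp_def algebra_simps simp del: power_Suc,
        auto simp: algebra_simps)
  then show ?thesis
    by (rule has_field_derivative_transform_within_open[of _ _ _ "{0<..}"])
      (use greater in \<open>auto simp: flat_exp_def\<close>)
next
  case equal
  have "((\<lambda>h. flat_exp m h / h) \<longlongrightarrow> 0) (at 0)"
  proof (subst filterlim_at_split, intro conjI)
    show "((\<lambda>h. flat_exp m h / h) \<longlongrightarrow> 0) (at_left 0)"
      by (rule tendsto_eventually) (auto simp: eventually_at_filter flat_exp_def)
    show "((\<lambda>h. flat_exp m h / h) \<longlongrightarrow> 0) (at_right 0)"
      by (rule Lim_transform_eventually[OF tendsto_flat_exp[of "Suc m"]])
        (auto simp: eventually_at_filter flat_exp_def divide_inverse mult_ac)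
  qed
  then show ?thesis using equal by (simp add: DERIV_def flat_exp_def[of _ 0])
qed

lemma C_k_flat_exp: "C_k k f \<Longrightarrow> C_k k (\<lambda>x. flat_exp m (f x))"
  by (rule C_k_compose[where h = flat_exp and D = UNIV])
    (use flat_exp_has_derivative in \<open>blast+\<close>)

section \<open>Test functions\<close>

lemma test_functions_C_k: "f \<in> test_functions \<Omega> \<Longrightarrow> C_k k f"
  by (simp add: test_functions_def)

lemma test_functions_continuous: "f \<in> test_functions \<Omega> \<Longrightarrow> continuous_on UNIV f"
  using test_functions_C_k[of f \<Omega> 0] by simp

lemma test_functions_eq_0: "f \<in> test_functions \<Omega> \<Longrightarrow> x \<notin> \<Omega> \<Longrightarrow> f x = 0"
  using closure_subset[of "{x. f x \<noteq> 0}"] by (auto simp: test_functions_def)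

lemma test_functions_mono_support:
  assumes f: "f \<in> test_functions \<Omega>" and g: "\<And>k. C_k k g" "\<And>x. f x = 0 \<Longrightarrow> g x = 0"
  shows "g \<in> test_functions \<Omega>"
proof -
  have sub: "closure {x. g x \<noteq> 0} \<subseteq> closure {x. f x \<noteq> 0}"
    using g(2) by (intro closure_mono) auto
  have "{x. g x \<noteq> 0} \<subseteq> {x. f x \<noteq> 0}" using g(2) by auto
  then have "compact (closure {x. g x \<noteq> 0})"
    using f bounded_subset[of "{x. f x \<noteq> 0}" "{x. g x \<noteq> 0}"] by (simp add: test_functions_def)
  then show ?thesis using f g sub by (auto simp: test_functions_def)
qed

lemma test_functions_cmult: "f \<in> test_functions \<Omega> \<Longrightarrow> (\<lambda>x. c * f x) \<in> test_functions \<Omega>"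
  by (rule test_functions_mono_support) (auto intro: test_functions_C_k)

text \<open>
  The subtraction of \<open>e\<close> makes the smoothed absolute value vanish at \<open>0\<close>, which keeps the support
  compact.
\<close>

lemma test_functions_smooth_abs:
  assumes f: "f \<in> test_functions \<Omega>" and e: "0 < e"
  shows "(\<lambda>x. sqrt ((f x)\<^sup>2 + e\<^sup>2) - e) \<in> test_functions \<Omega>"
proof (rule test_functions_mono_support[OF f])
  fix k
  have "C_k k (\<lambda>x. (f x * f x + e\<^sup>2) powr (1/2) + (- e))"
    using e test_functions_C_k[OF f]
    by (intro C_k_add C_k_powr C_k_mult C_k_const) (auto intro: add_nonneg_pos)
  then show "C_k k (\<lambda>x. sqrt ((f x)\<^sup>2 + e\<^sup>2) - e)"
    by (simp add: powr_half_sqrt power2_eq_square)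
qed (use e in auto)

lemma exists_bump_test_function:
  assumes "open \<Omega>" "z \<in> \<Omega>"
  obtains f where "f \<in> test_functions \<Omega>" "\<And>x. 0 \<le> f x" "0 < f z"
proof -
  obtain r where r: "0 < r" "cball z r \<subseteq> \<Omega>"
    using assms open_contains_cball by blast
  \<comment> \<open>This is \<open>r\<^sup>2 - \<bar>x - z\<bar>\<^sup>2\<close>, spelled out so that its smoothness is visible from the closure rules.\<close>
  define q where "q x = r\<^sup>2 + (-1) * (\<Sum>i\<in>Basis. (x \<bullet> i + - (z \<bullet> i)) * (x \<bullet> i + - (z \<bullet> i)))" for x
  have q: "q x = r\<^sup>2 - (norm (x - z))\<^sup>2" for x
    unfolding q_def power2_norm_eq_inner euclidean_inner[of "x - z" "x - z"]
    by (simp add: inner_diff_left)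
  define f where "f x = flat_exp 0 (q x)" for x
  have C: "C_k k f" for k
    unfolding f_def q_def by (intro C_k_flat_exp C_k_add C_k_mult C_k_const C_k_sum C_k_inner)
  have "{x. f x \<noteq> 0} \<subseteq> cball z r"
  proof
    fix x assume "x \<in> {x. f x \<noteq> 0}"
    then have "(norm (x - z))\<^sup>2 < r\<^sup>2" by (auto simp: f_def flat_exp_def q split: if_splits)
    then have "norm (x - z) < r" using r by (simp add: power2_less_imp_less)
    then show "x \<in> cball z r" by (simp add: dist_norm norm_minus_commute)
  qed
  then have *: "closure {x. f x \<noteq> 0} \<subseteq> cball z r" by (rule closure_minimal) simp
  then have "compact (closure {x. f x \<noteq> 0})"
    using bounded_subset[OF bounded_cball] compact_eq_bounded_closed by blast
  then have "f \<in> test_functions \<Omega>" using C * r by (auto simp: test_functions_def)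
  moreover have "0 \<le> f x" for x by (simp add: f_def flat_exp_def)
  moreover have "0 < f z" using r by (simp add: f_def flat_exp_def q)
  ultimately show ?thesis using that by blast
qed

lemma bounded_of_compact_support:
  fixes g :: "'a::euclidean_space \<Rightarrow> real"
  assumes "continuous_on UNIV g" "compact K" "\<And>x. x \<notin> K \<Longrightarrow> g x = 0"
  obtains M where "0 \<le> M" "\<And>x. \<bar>g x\<bar> \<le> M"
proof -
  have "bounded (g ` K)"
    using assms(2) continuous_on_subset[OF assms(1) subset_UNIV]
    by (intro compact_imp_bounded compact_continuous_image)
  then obtain M where "\<And>x. x \<in> K \<Longrightarrow> \<bar>g x\<bar> \<le> M" by (auto simp: bounded_iff)
  then have "\<bar>g x\<bar> \<le> max M 0" for x using assms(3)[of x] by (cases "x \<in> K") (auto intro: max.coboundedI1)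
  then show ?thesis using that[of "max M 0"] by simp
qed

lemma test_functions_bounded:
  assumes "f \<in> test_functions \<Omega>"
  obtains M where "0 \<le> M" "\<And>x. \<bar>f x\<bar> \<le> M"
proof (rule bounded_of_compact_support)
  show "continuous_on UNIV f" using assms by (rule test_functions_continuous)
  show "compact (closure {x. f x \<noteq> 0})" using assms by (simp add: test_functions_def)
  show "f x = 0" if "x \<notin> closure {x. f x \<noteq> 0}" for x
    using that closure_subset[of "{x. f x \<noteq> 0}"] by auto
qed (rule that)

text \<open>
  The partial derivatives are continuous and vanish off the compact support, hence are bounded; the
  mean value inequality does the rest.
\<close>

lemma test_functions_lipschitz:
  assumes f: "f \<in> test_functions \<Omega>"
  obtains L where "0 \<le> L" "\<And>x y. \<bar>f x - f y\<bar> \<le> L * norm (x - y)"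
proof -
  let ?K = "closure {x. f x \<noteq> 0}"
  let ?D = "\<lambda>x. frechet_derivative f (at x)"
  have C1: "C_k (Suc 0) f" using f by (rule test_functions_C_k)
  have der: "(f has_derivative ?D x) (at x)" for x using C1 by (rule C_k_Suc_has_derivative)
  have "\<exists>M\<ge>0. \<forall>x. \<bar>?D x b\<bar> \<le> M" if "b \<in> Basis" for b
  proof (rule bounded_of_compact_support)
    show "continuous_on UNIV (\<lambda>x. ?D x b)" using C1 that by simp
    show "compact ?K" using f by (simp add: test_functions_def)
    show "?D x b = 0" if x: "x \<notin> ?K" for x
    proof -
      have "(f has_derivative (\<lambda>_. 0)) (at x)"
      proof (rule has_derivative_transform_within_open)
        show "((\<lambda>_. 0) has_derivative (\<lambda>_. 0)) (at x)" by simp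
        show "open (- ?K)" by (simp add: open_closed)
        show "x \<in> - ?K" using x by simp
        show "0 = f y" if "y \<in> - ?K" for y using that closure_subset[of "{x. f x \<noteq> 0}"] by auto
      qed
      from fun_cong[OF frechet_derivative_at[OF this], of b] show ?thesis by simp
    qed
  qed blast
  then have "\<forall>b\<in>Basis. \<exists>M. 0 \<le> M \<and> (\<forall>x. \<bar>?D x b\<bar> \<le> M)" by blast
  from bchoice[OF this] obtain M
    where M: "\<And>b. b \<in> Basis \<Longrightarrow> 0 \<le> M b" "\<And>b x. b \<in> Basis \<Longrightarrow> \<bar>?D x b\<bar> \<le> M b"
    by blast
  show ?thesis
  proof (rule that)
    show "0 \<le> sum M Basis" using M(1) by (simp add: sum_nonneg)
    fix x y
    have "norm (f x - f y) \<le> sum M Basis * norm (x - y)"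
    proof (rule differentiable_bound[where S = UNIV])
      show "(f has_derivative ?D z) (at z within UNIV)" for z using der by simp
      show "onorm (?D z) \<le> sum M Basis" for z
        using M(2) by (intro onorm_componentwise_le has_derivative_bounded_linear[OF der] sum_mono) auto
    qed auto
    then show "\<bar>f x - f y\<bar> \<le> sum M Basis * norm (x - y)" by simp
  qed
qed

section \<open>The Gagliardo energy\<close>

lemma sigma_finite_lebesgue: "sigma_finite_measure (lebesgue :: 'a::euclidean_space measure)"
proof
  show "\<exists>A::'a set set. countable A \<and> A \<subseteq> sets lebesgue \<and> \<Union> A = space lebesgue \<and>
      (\<forall>a\<in>A. emeasure lebesgue a \<noteq> \<infinity>)"
    by (intro exI[of _ "range (\<lambda>n::nat. cball 0 (real n))"])
      (auto simp: emeasure_cball set_eq_iff intro: real_arch_simple)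
qed

interpretation lebesgue: sigma_finite_measure "lebesgue :: 'a::euclidean_space measure"
  by (rule sigma_finite_lebesgue)

interpretation lebesgue_pair: pair_sigma_finite
  "lebesgue :: 'a::euclidean_space measure" "lebesgue :: 'b::euclidean_space measure" ..

lemma measurable_fst_lebesgue [measurable]:
  "fst \<in> borel_measurable (lebesgue \<Otimes>\<^sub>M lebesgue :: ('a::euclidean_space \<times> 'b::euclidean_space) measure)"
  by (rule measurable_compose[OF measurable_fst]) (simp add: measurable_completion)

lemma measurable_snd_lebesgue [measurable]:
  "snd \<in> borel_measurable (lebesgue \<Otimes>\<^sub>M lebesgue :: ('a::euclidean_space \<times> 'b::euclidean_space) measure)"
  by (rule measurable_compose[OF measurable_snd]) (simp add: measurable_completion)

lemma gagliardo_integrand_nonneg: "0 \<le> gagliardo_integrand s p u z"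
  by (simp add: gagliardo_integrand_def case_prod_unfold)

lemma borel_measurable_gagliardo_integrand [measurable]:
  fixes u :: "'a::euclidean_space \<Rightarrow> real"
  assumes u [measurable]: "u \<in> borel_measurable lebesgue"
  shows "gagliardo_integrand s p u \<in> borel_measurable (lebesgue \<Otimes>\<^sub>M lebesgue)"
  unfolding gagliardo_integrand_def case_prod_unfold by measurable

lemma exists_dyadic_bracket:
  fixes t :: real
  assumes "1 \<le> t"
  obtains k :: nat where "2 ^ k \<le> t" "t < 2 ^ Suc k"
proof -
  obtain n :: nat where n: "t < 2 ^ n" using real_arch_pow[of 2 t] by auto
  define m where "m = (LEAST n. t < 2 ^ n)"
  have m: "t < 2 ^ m" unfolding m_def using n by (rule LeastI)
  have "m \<noteq> 0" using m assms by (cases m) auto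
  then obtain k where k: "m = Suc k" using not0_implies_Suc by blast
  have "\<not> t < 2 ^ k" using not_less_Least[of k "\<lambda>n. t < 2 ^ n"] k unfolding m_def by simp
  then show ?thesis using that[of k] m k by simp
qed

text \<open>
  The kernel \<open>\<bar>x - y\<bar>\<^sup>-\<^sup>N\<^sup>-\<^sup>s\<^sup>p\<close> is too singular to be integrated by itself. Near \<open>x\<close> the increment
  compensates, since \<open>\<bar>g y\<bar>\<^sup>p \<le> L\<^sup>p \<bar>x - y\<bar>\<^sup>p\<close> and \<open>s < 1\<close>; away from \<open>x\<close> boundedness of \<open>g\<close> suffices,
  since \<open>s > 0\<close>. On each dyadic shell the integrand is at most a constant times the indicator
  of a ball, and the integrals of these majorants form two geometric series with ratios
  \<open>2\<^sup>-\<^sup>p\<^sup>(\<^sup>1\<^sup>-\<^sup>s\<^sup>)\<close> and \<open>2\<^sup>-\<^sup>s\<^sup>p\<close>. The constant depends neither on \<open>g\<close> nor on \<open>x\<close>, as integration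
  in \<open>x\<close> over the support of a test function demands.
\<close>

lemma nn_integral_gagliardo_slice:
  fixes s p L M :: real
  assumes sp: "0 < s" "s < 1" "1 < p" and LM: "0 \<le> L" "0 \<le> M"
  shows "\<exists>C::real. \<forall>g (x::'a::euclidean_space). (\<forall>y. \<bar>g y\<bar> \<le> L * norm (x - y)) \<longrightarrow> (\<forall>y. \<bar>g y\<bar> \<le> M) \<longrightarrow>
    (\<integral>\<^sup>+ y. ennreal (\<bar>g y\<bar> powr p / norm (x - y) powr (real DIM('a) + s * p)) \<partial>lebesgue) \<le> ennreal C"
proof -
  let ?d = "real DIM('a)"
  define V where "V = unit_ball_vol ?d"
  define e where "e = ?d + s * p"
  have V: "0 \<le> V" and e: "0 \<le> e" using sp by (auto simp: V_def e_def)
  define \<alpha> where "\<alpha> k = (L / 2 ^ k) powr p * (2 ^ Suc k) powr e" for k :: nat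
  define \<beta> where "\<beta> k = M powr p / (2 ^ k) powr e" for k :: nat
  define A where "A = L powr p * V * 2 powr e"
  define B where "B = M powr p * V * 2 powr ?d"
  have two_powr: "(2::real) ^ k = 2 powr real k" "(2::real) ^ Suc k = 2 powr (1 + real k)"
    "1 / 2 ^ k = 2 powr (- real k)" "L / 2 ^ k = L * 2 powr (- real k)" for k :: nat
    by (simp_all add: powr_minus powr_add powr_realpow divide_inverse)
  have two_powr_power: "(2 powr x) ^ n = 2 powr (x * real n)" for x :: real and n
    by (simp add: powr_powr flip: powr_realpow)
  have L_powr: "(L * 2 powr x) powr p = L powr p * 2 powr (x * p)" for x
    using LM by (simp add: powr_mult powr_powr)
  have A: "\<alpha> k * (V * (1 / 2 ^ k) ^ DIM('a)) = A * (2 powr (- (p * (1 - s)))) ^ k" for k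
  proof -
    have "\<alpha> k * (V * (1 / 2 ^ k) ^ DIM('a))
        = (L powr p * 2 powr (- (real k * p))) * 2 powr ((1 + real k) * e) * (V * 2 powr (- (real k * ?d)))"
      unfolding \<alpha>_def two_powr(2-) two_powr_power L_powr powr_powr by simp
    also have "\<dots> = L powr p * V * 2 powr (- (real k * p) + (1 + real k) * e + - (real k * ?d))"
      by (simp only: powr_add mult_ac)
    also have "- (real k * p) + (1 + real k) * e + - (real k * ?d) = e + real k * (- (p * (1 - s)))"
      by (simp add: e_def algebra_simps)
    also have "L powr p * V * 2 powr (e + real k * (- (p * (1 - s)))) = A * (2 powr (- (p * (1 - s)))) ^ k"
      by (simp only: powr_add A_def two_powr_power mult_ac)
    finally show ?thesis .
  qed
  have B: "\<beta> k * (V * (2 ^ Suc k) ^ DIM('a)) = B * (2 powr (- (s * p))) ^ k" for k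
  proof -
    have "\<beta> k * (V * (2 ^ Suc k) ^ DIM('a))
        = M powr p * 2 powr (- (real k * e)) * (V * 2 powr ((1 + real k) * ?d))"
      unfolding \<beta>_def two_powr(1,2) two_powr_power powr_powr divide_inverse powr_minus[symmetric]
      by simp
    also have "\<dots> = M powr p * V * 2 powr (- (real k * e) + (1 + real k) * ?d)"
      by (simp only: powr_add mult_ac)
    also have "- (real k * e) + (1 + real k) * ?d = ?d + real k * (- (s * p))"
      by (simp add: e_def algebra_simps)
    also have "M powr p * V * 2 powr (?d + real k * (- (s * p))) = B * (2 powr (- (s * p))) ^ k"
      by (simp only: powr_add B_def two_powr_power mult_ac)
    finally show ?thesis .
  qed
  have geo: "summable (\<lambda>k. A * (2 powr (- (p * (1 - s)))) ^ k)" "summable (\<lambda>k. B * (2 powr (- (s * p))) ^ k)"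
    using sp by (intro summable_mult summable_geometric; simp add: powr_minus powr_less_one inverse_less_1_iff)+
  have \<alpha>0: "0 \<le> \<alpha> k" and \<beta>0: "0 \<le> \<beta> k" for k by (auto simp: \<alpha>_def \<beta>_def)
  define C where "C = (\<Sum>k. A * (2 powr (- (p * (1 - s)))) ^ k + B * (2 powr (- (s * p))) ^ k)"
  show ?thesis
  proof (intro exI[of _ C] allI impI)
    fix g :: "'a \<Rightarrow> real" and x :: 'a
    assume "\<forall>y. \<bar>g y\<bar> \<le> L * norm (x - y)" "\<forall>y. \<bar>g y\<bar> \<le> M"
    then have g: "\<bar>g y\<bar> \<le> L * norm (x - y)" "\<bar>g y\<bar> \<le> M" for y by blast+
    define T where "T k y = ennreal (\<alpha> k) * indicator (cball x (1 / 2 ^ k)) y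
        + ennreal (\<beta> k) * indicator (cball x (2 ^ Suc k)) y" for k y
    have [measurable]: "cball x r \<in> sets borel" for r by simp
    \<comment> \<open>Every point lies in a dyadic shell, where a single summand already dominates the integrand.\<close>
    have T: "ennreal (\<bar>g y\<bar> powr p / norm (x - y) powr e) \<le> (\<Sum>k. T k y)" for y
    proof -
      define t where "t = norm (x - y)"
      have "\<exists>k. ennreal (\<bar>g y\<bar> powr p / t powr e) \<le> T k y"
      proof -
        consider "t = 0" | "0 < t" "t < 1" | "1 \<le> t" by (fastforce simp: t_def)
        then show ?thesis
        proof cases
          case 1
          then show ?thesis using g(1)[of y] sp by (simp add: t_def)
        next
          case 2
          then have "1 \<le> 1 / t" by simp
          then obtain k where k: "2 ^ k \<le> 1 / t" "1 / t < 2 ^ Suc k" using exists_dyadic_bracket by blast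
          have tk: "t \<le> 1 / 2 ^ k" "1 / 2 ^ Suc k \<le> t" using k 2 by (simp_all add: field_simps)
          have "\<bar>g y\<bar> powr p \<le> (L / 2 ^ k) powr p"
            using g(1)[of y] tk(1) LM mult_left_mono[OF tk(1), of L] sp
            by (intro powr_mono2) (auto simp: t_def)
          moreover have "1 / t powr e \<le> (2 ^ Suc k) powr e"
            using powr_mono2[of e "1 / t" "2 ^ Suc k"] k 2 e by (simp add: powr_divide)
          ultimately have "\<bar>g y\<bar> powr p * (1 / t powr e) \<le> \<alpha> k"
            unfolding \<alpha>_def by (intro mult_mono) auto
          then show ?thesis
            using tk(1) by (intro exI[of _ k]) (auto simp: T_def t_def dist_norm intro!: add_increasing2 ennreal_leI)
        next
          case 3
          then obtain k where k: "2 ^ k \<le> t" "t < 2 ^ Suc k" using exists_dyadic_bracket by blast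
          have "\<bar>g y\<bar> powr p \<le> M powr p" using g(2) sp by (intro powr_mono2) auto
          moreover have "(2 ^ k) powr e \<le> t powr e" using k e by (intro powr_mono2) auto
          ultimately have "\<bar>g y\<bar> powr p / t powr e \<le> \<beta> k"
            unfolding \<beta>_def by (intro frac_le) auto
          then show ?thesis
            using k by (intro exI[of _ k]) (auto simp: T_def t_def dist_norm intro!: add_increasing ennreal_leI)
        qed
      qed
      then obtain k where "ennreal (\<bar>g y\<bar> powr p / t powr e) \<le> T k y" by blast
      also have "T k y \<le> (\<Sum>k. T k y)" using sum_le_suminf[of "\<lambda>k. T k y" "{k}"] by simp
      finally show ?thesis by (simp add: t_def)
    qed
    have "(\<integral>\<^sup>+ y. ennreal (\<bar>g y\<bar> powr p / norm (x - y) powr e) \<partial>lebesgue) \<le> (\<integral>\<^sup>+ y. (\<Sum>k. T k y) \<partial>lborel)"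
      unfolding nn_integral_completion by (intro nn_integral_mono T)
    also have "\<dots> = (\<Sum>k. \<integral>\<^sup>+ y. T k y \<partial>lborel)"
      unfolding T_def by (rule nn_integral_suminf) measurable
    also have "\<dots> = (\<Sum>k. ennreal (A * (2 powr (- (p * (1 - s)))) ^ k + B * (2 powr (- (s * p))) ^ k))"
    proof (rule suminf_cong)
      fix k
      have "(\<integral>\<^sup>+ y. T k y \<partial>lborel) = ennreal (\<alpha> k) * ennreal (V * (1 / 2 ^ k) ^ DIM('a))
          + ennreal (\<beta> k) * ennreal (V * (2 ^ Suc k) ^ DIM('a))"
        unfolding T_def V_def
        by (subst nn_integral_add; (subst nn_integral_cmult_indicator)?)
          (simp_all add: nn_integral_cmult_indicator emeasure_cball)
      also have "\<dots> = ennreal (\<alpha> k * (V * (1 / 2 ^ k) ^ DIM('a)) + \<beta> k * (V * (2 ^ Suc k) ^ DIM('a)))"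
        using \<alpha>0 \<beta>0 V by (simp add: ennreal_mult' ennreal_plus)
      finally show "(\<integral>\<^sup>+ y. T k y \<partial>lborel)
          = ennreal (A * (2 powr (- (p * (1 - s)))) ^ k + B * (2 powr (- (s * p))) ^ k)"
        unfolding A B .
    qed
    also have "\<dots> = ennreal C"
      unfolding C_def
    proof (rule suminf_ennreal2)
      show "0 \<le> A * (2 powr (- (p * (1 - s)))) ^ k + B * (2 powr (- (s * p))) ^ k" for k
        using V by (simp add: A_def B_def)
      show "summable (\<lambda>k. A * (2 powr (- (p * (1 - s)))) ^ k + B * (2 powr (- (s * p))) ^ k)"
        using geo by (rule summable_add)
    qed
    finally show "(\<integral>\<^sup>+ y. ennreal (\<bar>g y\<bar> powr p / norm (x - y) powr (real DIM('a) + s * p)) \<partial>lebesgue) \<le> ennreal C"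
      by (simp add: e_def)
  qed
qed

text \<open>
  An increment of \<open>f\<close> is nonzero only if one of the two points lies in the compact support \<open>K\<close>. So the
  double integral is at most the sum of two, with \<open>x\<close> or \<open>y\<close> restricted to \<open>K\<close>; each is bounded by the
  measure of \<open>K\<close> times the uniform bound for slices.
\<close>

lemma test_functions_gagliardo_integrable:
  fixes f :: "'a::euclidean_space \<Rightarrow> real"
  assumes sp: "0 < s" "s < 1" "1 < p" and f: "f \<in> test_functions \<Omega>"
  shows "integrable (lebesgue \<Otimes>\<^sub>M lebesgue) (gagliardo_integrand s p f)"
proof (rule integrableI_nonneg)
  let ?I = "gagliardo_integrand s p f"
  define K where "K = closure {x. f x \<noteq> 0}"
  have K: "compact K" using f by (simp add: test_functions_def K_def)
  have fK: "f x = 0" if "x \<notin> K" for x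
    using that closure_subset[of "{x. f x \<noteq> 0}"] by (auto simp: K_def)
  have mK [measurable]: "K \<in> sets lebesgue" using K by (simp add: borel_compact)
  have finK: "emeasure lebesgue K < \<infinity>" using K emeasure_compact_finite[of K] by (simp add: borel_compact)
  have "f \<in> borel_measurable borel"
    using f by (intro borel_measurable_continuous_onI test_functions_continuous)
  then have mf [measurable]: "f \<in> borel_measurable lebesgue"
    by (intro measurable_completion) simp
  show mI: "?I \<in> borel_measurable (lebesgue \<Otimes>\<^sub>M lebesgue)" by measurable
  note [measurable] = mI
  show "AE z in lebesgue \<Otimes>\<^sub>M lebesgue. 0 \<le> ?I z" by (simp add: gagliardo_integrand_nonneg)
  obtain M where M: "0 \<le> M" "\<And>x. \<bar>f x\<bar> \<le> M" using test_functions_bounded[OF f] by metis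
  have M2: "0 \<le> 2 * M" using M(1) by simp
  obtain L where L: "0 \<le> L" "\<And>x y. \<bar>f x - f y\<bar> \<le> L * norm (x - y)"
    using test_functions_lipschitz[OF f] by metis
  obtain C where C: "\<And>g (x::'a). (\<And>y. \<bar>g y\<bar> \<le> L * norm (x - y)) \<Longrightarrow> (\<And>y. \<bar>g y\<bar> \<le> 2 * M) \<Longrightarrow>
    (\<integral>\<^sup>+ y. ennreal (\<bar>g y\<bar> powr p / norm (x - y) powr (real DIM('a) + s * p)) \<partial>lebesgue) \<le> ennreal C"
    using nn_integral_gagliardo_slice[OF sp L(1) M2, where 'a = 'a] by blast
  have f2: "\<bar>f x - f y\<bar> \<le> 2 * M" for x y using M(2)[of x] M(2)[of y] by linarith
  have slice: "(\<integral>\<^sup>+ y. ennreal (?I (x, y)) \<partial>lebesgue) \<le> ennreal C" for x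
    unfolding gagliardo_integrand_def prod.case by (rule C) (use L f2 in auto)
  have sym: "?I (x, y) = ?I (y, x)" for x y
    by (simp add: gagliardo_integrand_def abs_minus_commute norm_minus_commute)
  have slice2: "(\<integral>\<^sup>+ x. ennreal (?I (x, y)) \<partial>lebesgue) \<le> ennreal C" for y
    using slice[of y] by (subst sym)
  have half: "(\<integral>\<^sup>+ x. indicator K x * h x \<partial>lebesgue) \<le> ennreal C * emeasure lebesgue K"
    if "\<And>x. h x \<le> ennreal C" for h
  proof -
    have "(\<integral>\<^sup>+ x. indicator K x * h x \<partial>lebesgue) \<le> (\<integral>\<^sup>+ x. ennreal C * indicator K x \<partial>lebesgue)"
      using that by (intro nn_integral_mono) (auto simp: indicator_def)
    also have "\<dots> = ennreal C * emeasure lebesgue K" by (rule nn_integral_cmult_indicator) measurable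
    finally show ?thesis .
  qed
  have "(\<integral>\<^sup>+ z. ennreal (?I z) \<partial>(lebesgue \<Otimes>\<^sub>M lebesgue))
      \<le> (\<integral>\<^sup>+ z. indicator K (fst z) * ennreal (?I z) + indicator K (snd z) * ennreal (?I z) \<partial>(lebesgue \<Otimes>\<^sub>M lebesgue))"
    using fK by (intro nn_integral_mono) (auto simp: indicator_def gagliardo_integrand_def)
  also have "\<dots> = (\<integral>\<^sup>+ z. indicator K (fst z) * ennreal (?I z) \<partial>(lebesgue \<Otimes>\<^sub>M lebesgue))
      + (\<integral>\<^sup>+ z. indicator K (snd z) * ennreal (?I z) \<partial>(lebesgue \<Otimes>\<^sub>M lebesgue))"
    by (rule nn_integral_add) measurable
  also have "(\<integral>\<^sup>+ z. indicator K (fst z) * ennreal (?I z) \<partial>(lebesgue \<Otimes>\<^sub>M lebesgue))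
      = (\<integral>\<^sup>+ x. indicator K x * (\<integral>\<^sup>+ y. ennreal (?I (x, y)) \<partial>lebesgue) \<partial>lebesgue)"
    by (subst lebesgue.nn_integral_fst[symmetric]) (auto simp: nn_integral_cmult)
  also have "(\<integral>\<^sup>+ z. indicator K (snd z) * ennreal (?I z) \<partial>(lebesgue \<Otimes>\<^sub>M lebesgue))
      = (\<integral>\<^sup>+ y. indicator K y * (\<integral>\<^sup>+ x. ennreal (?I (x, y)) \<partial>lebesgue) \<partial>lebesgue)"
    by (subst lebesgue_pair.nn_integral_snd[symmetric]) (auto simp: nn_integral_cmult)
  also have "(\<integral>\<^sup>+ x. indicator K x * (\<integral>\<^sup>+ y. ennreal (?I (x, y)) \<partial>lebesgue) \<partial>lebesgue)
      + (\<integral>\<^sup>+ y. indicator K y * (\<integral>\<^sup>+ x. ennreal (?I (x, y)) \<partial>lebesgue) \<partial>lebesgue)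
      \<le> ennreal C * emeasure lebesgue K + ennreal C * emeasure lebesgue K"
    by (intro add_mono half slice slice2)
  also have "\<dots> < \<infinity>" using finK by (simp add: ennreal_mult_less_top)
  finally show "(\<integral>\<^sup>+ z. ennreal (?I z) \<partial>(lebesgue \<Otimes>\<^sub>M lebesgue)) < \<infinity>" .
qed

definition gagliardo_energy :: "real \<Rightarrow> real \<Rightarrow> ('a::euclidean_space \<Rightarrow> real) \<Rightarrow> real" where
  "gagliardo_energy s p u = integral\<^sup>L (lebesgue \<Otimes>\<^sub>M lebesgue) (gagliardo_integrand s p u)"

lemma gagliardo_energy_nonneg: "0 \<le> gagliardo_energy s p u"
  by (simp add: gagliardo_energy_def gagliardo_integrand_nonneg)

lemma gagliardo_powr: "p \<noteq> 0 \<Longrightarrow> gagliardo s p u powr p = gagliardo_energy s p u"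
  using gagliardo_energy_nonneg[of s p u]
  by (simp add: gagliardo_def gagliardo_energy_def powr_powr)

lemma gagliardo_integrand_cmult:
  "gagliardo_integrand s p (\<lambda>x. c * u x) z = \<bar>c\<bar> powr p * gagliardo_integrand s p u z"
proof -
  have "\<bar>c * u x - c * u y\<bar> powr p = \<bar>c\<bar> powr p * \<bar>u x - u y\<bar> powr p" for x y
    by (simp add: abs_mult powr_mult flip: right_diff_distrib)
  then show ?thesis by (simp add: gagliardo_integrand_def case_prod_unfold)
qed

lemma gagliardo_energy_cmult:
  "gagliardo_energy s p (\<lambda>x. c * u x) = \<bar>c\<bar> powr p * gagliardo_energy s p u"
  by (simp add: gagliardo_energy_def gagliardo_integrand_cmult[abs_def])

lemma gagliardo_cmult:
  assumes "0 < p"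
  shows "gagliardo s p (\<lambda>x. c * u x) = \<bar>c\<bar> * gagliardo s p u"
  using assms gagliardo_energy_nonneg[of s p u]
  by (simp add: gagliardo_def gagliardo_energy_def gagliardo_integrand_cmult[abs_def] powr_mult powr_powr)

lemma L_norm_cmult:
  assumes "0 < p"
  shows "L_norm \<Omega> p (\<lambda>x. c * u x) = \<bar>c\<bar> * L_norm \<Omega> p u"
proof -
  have "0 \<le> (LINT x:\<Omega>|lebesgue. \<bar>u x\<bar> powr p)"
    by (simp add: set_lebesgue_integral_def)
  then show ?thesis using assms by (simp add: L_norm_def abs_mult powr_mult powr_powr)
qed

lemma L_norm_one: "L_norm \<Omega> 1 u = (LINT x:\<Omega>|lebesgue. \<bar>u x\<bar>)"
proof -
  have "0 \<le> (LINT x:\<Omega>|lebesgue. \<bar>u x\<bar>)" by (simp add: set_lebesgue_integral_def)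
  then show ?thesis by (simp add: L_norm_def)
qed

lemma gagliardo_integrand_add_le:
  assumes "1 < p" "0 < \<delta>" "\<delta> < 1"
  shows "gagliardo_integrand s p (\<lambda>x. u x + v x) z
    \<le> (1 - \<delta>) powr (1 - p) * gagliardo_integrand s p u z + \<delta> powr (1 - p) * gagliardo_integrand s p v z"
proof -
  obtain x y where z: "z = (x, y)" by (cases z)
  have "\<bar>u x + v x - (u y + v y)\<bar> powr p
      \<le> (1 - \<delta>) powr (1 - p) * \<bar>u x - u y\<bar> powr p + \<delta> powr (1 - p) * \<bar>v x - v y\<bar> powr p"
    using abs_add_powr_le[OF assms, of "u x - u y" "v x - v y"] by (simp add: algebra_simps)
  from divide_right_mono[OF this, of "norm (x - y) powr (real DIM('a) + s * p)"]
  show ?thesis by (simp add: z gagliardo_integrand_def add_divide_distrib)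
qed

text \<open>
  Maps that do not increase distances, such as the absolute value and its smoothing, do not
  increase the energy.
\<close>

lemma gagliardo_integrand_contraction:
  assumes "0 \<le> p" "\<And>x y. \<bar>v x - v y\<bar> \<le> \<bar>u x - u y\<bar>"
  shows "gagliardo_integrand s p v z \<le> gagliardo_integrand s p u z"
  using assms by (auto simp: gagliardo_integrand_def case_prod_unfold intro!: divide_right_mono powr_mono2)

section \<open>Sobolev--Slobodeckij spaces on a bounded open set\<close>

lemma W_measurable: "u \<in> W s p \<Omega> \<Longrightarrow> u \<in> borel_measurable lebesgue"
  by (simp add: W_def)

lemma W_vanishes: "u \<in> W s p \<Omega> \<Longrightarrow> AE x in lebesgue. x \<notin> \<Omega> \<longrightarrow> u x = 0"
  by (simp add: W_def)

lemma W_powr_integrable: "u \<in> W s p \<Omega> \<Longrightarrow> set_integrable lebesgue \<Omega> (\<lambda>x. \<bar>u x\<bar> powr p)"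
  by (simp add: W_def)

lemma W_gagliardo_integrable:
  "u \<in> W s p \<Omega> \<Longrightarrow> integrable (lebesgue \<Otimes>\<^sub>M lebesgue) (gagliardo_integrand s p u)"
  by (simp add: W_def)

lemma W0_imp_W: "u \<in> W0 s p \<Omega> \<Longrightarrow> u \<in> W s p \<Omega>"
  by (simp add: W0_def)

lemma W_cmult:
  assumes "u \<in> W s p \<Omega>"
  shows "(\<lambda>x. c * u x) \<in> W s p \<Omega>"
  using assms unfolding W_def
  by (auto simp: gagliardo_integrand_cmult[abs_def] abs_mult powr_mult)

lemma W0_cmult:
  assumes p: "0 < p" and u: "u \<in> W0 s p \<Omega>"
  shows "(\<lambda>x. c * u x) \<in> W0 s p \<Omega>"
  unfolding W0_def
proof (intro CollectI conjI allI impI)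
  show "(\<lambda>x. c * u x) \<in> W s p \<Omega>" using u by (intro W_cmult W0_imp_W)
  fix \<epsilon> :: real assume \<epsilon>: "0 < \<epsilon>"
  have c1: "0 < \<bar>c\<bar> + 1" by simp
  obtain f where f: "f \<in> test_functions \<Omega>"
    and fe: "gagliardo s p (\<lambda>x. u x - f x) + L_norm \<Omega> p (\<lambda>x. u x - f x) < \<epsilon> / (\<bar>c\<bar> + 1)"
    using u \<epsilon> c1 divide_pos_pos[OF \<epsilon> c1] unfolding W0_def by blast
  let ?N = "gagliardo s p (\<lambda>x. u x - f x) + L_norm \<Omega> p (\<lambda>x. u x - f x)"
  have "0 \<le> ?N" by (simp add: gagliardo_def L_norm_def)
  then have "\<bar>c\<bar> * ?N \<le> (\<bar>c\<bar> + 1) * ?N" by (intro mult_right_mono) auto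
  also have "\<dots> < \<epsilon>" using fe by (simp add: field_simps)
  finally have "\<bar>c\<bar> * ?N < \<epsilon>" .
  moreover have "gagliardo s p (\<lambda>x. c * u x - c * f x) + L_norm \<Omega> p (\<lambda>x. c * u x - c * f x) = \<bar>c\<bar> * ?N"
    unfolding right_diff_distrib[symmetric]
    by (simp only: gagliardo_cmult[OF p] L_norm_cmult[OF p] distrib_left)
  ultimately show "\<exists>g\<in>test_functions \<Omega>.
      gagliardo s p (\<lambda>x. c * u x - g x) + L_norm \<Omega> p (\<lambda>x. c * u x - g x) < \<epsilon>"
    using test_functions_cmult[OF f, of c] by (intro bexI[of _ "\<lambda>x. c * f x"]) auto
qed

lemma W_add:
  assumes p: "1 < p" and \<Omega>: "open \<Omega>" and u: "u \<in> W s p \<Omega>" and v: "v \<in> W s p \<Omega>"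
  shows "(\<lambda>x. u x + v x) \<in> W s p \<Omega>"
  unfolding W_def
proof (intro CollectI conjI)
  note [measurable] = W_measurable[OF u] W_measurable[OF v]
  have [measurable]: "\<Omega> \<in> sets lebesgue" using \<Omega> by simp
  show m: "(\<lambda>x. u x + v x) \<in> borel_measurable lebesgue" by measurable
  show "AE x in lebesgue. x \<notin> \<Omega> \<longrightarrow> u x + v x = 0"
    using W_vanishes[OF u] W_vanishes[OF v] by eventually_elim simp
  let ?k = "(1 / 2) powr (1 - p)"
  have half: "\<bar>a + b\<bar> powr p \<le> ?k * \<bar>a\<bar> powr p + ?k * \<bar>b\<bar> powr p" for a b :: real
    using abs_add_powr_le[OF p, of "1/2" a b] by simp
  show "set_integrable lebesgue \<Omega> (\<lambda>x. \<bar>u x + v x\<bar> powr p)"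
  proof (rule set_integrable_bound)
    show "set_integrable lebesgue \<Omega> (\<lambda>x. ?k * \<bar>u x\<bar> powr p + ?k * \<bar>v x\<bar> powr p)"
      using W_powr_integrable[OF u] W_powr_integrable[OF v] by (intro set_integral_add set_integrable_mult_right)
    show "set_borel_measurable lebesgue \<Omega> (\<lambda>x. \<bar>u x + v x\<bar> powr p)"
      unfolding set_borel_measurable_def by measurable
    show "AE x in lebesgue. x \<in> \<Omega> \<longrightarrow> norm (\<bar>u x + v x\<bar> powr p) \<le> norm (?k * \<bar>u x\<bar> powr p + ?k * \<bar>v x\<bar> powr p)"
      using half by (intro AE_I2) (simp add: abs_of_nonneg)
  qed
  show "integrable (lebesgue \<Otimes>\<^sub>M lebesgue) (gagliardo_integrand s p (\<lambda>x. u x + v x))"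
  proof (rule Bochner_Integration.integrable_bound)
    show "integrable (lebesgue \<Otimes>\<^sub>M lebesgue) (\<lambda>z. ?k * gagliardo_integrand s p u z + ?k * gagliardo_integrand s p v z)"
      using W_gagliardo_integrable[OF u] W_gagliardo_integrable[OF v] by simp
    show "gagliardo_integrand s p (\<lambda>x. u x + v x) \<in> borel_measurable (lebesgue \<Otimes>\<^sub>M lebesgue)"
      using m by (rule borel_measurable_gagliardo_integrand)
    show "AE z in lebesgue \<Otimes>\<^sub>M lebesgue. norm (gagliardo_integrand s p (\<lambda>x. u x + v x) z)
        \<le> norm (?k * gagliardo_integrand s p u z + ?k * gagliardo_integrand s p v z)"
      using gagliardo_integrand_add_le[OF p, of "1/2" s u v]
      by (intro AE_I2) (simp add: abs_of_nonneg gagliardo_integrand_nonneg)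
  qed
qed

lemma W_diff:
  assumes "1 < p" "open \<Omega>" "u \<in> W s p \<Omega>" "v \<in> W s p \<Omega>"
  shows "(\<lambda>x. u x - v x) \<in> W s p \<Omega>"
  using W_add[OF assms(1-3) W_cmult[OF assms(4), of "-1"]] by simp

lemma gagliardo_energy_add_le:
  assumes "1 < p" "0 < \<delta>" "\<delta> < 1" "open \<Omega>" and u: "u \<in> W s p \<Omega>" and v: "v \<in> W s p \<Omega>"
  shows "gagliardo_energy s p (\<lambda>x. u x + v x)
    \<le> (1 - \<delta>) powr (1 - p) * gagliardo_energy s p u + \<delta> powr (1 - p) * gagliardo_energy s p v"
proof -
  have "gagliardo_energy s p (\<lambda>x. u x + v x) \<le> integral\<^sup>L (lebesgue \<Otimes>\<^sub>M lebesgue)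
      (\<lambda>z. (1 - \<delta>) powr (1 - p) * gagliardo_integrand s p u z + \<delta> powr (1 - p) * gagliardo_integrand s p v z)"
    unfolding gagliardo_energy_def
    using assms W_gagliardo_integrable[OF u] W_gagliardo_integrable[OF v]
    by (intro integral_mono gagliardo_integrand_add_le W_gagliardo_integrable[OF W_add[OF assms(1,4) u v]]) auto
  also have "\<dots> = (1 - \<delta>) powr (1 - p) * gagliardo_energy s p u + \<delta> powr (1 - p) * gagliardo_energy s p v"
    unfolding gagliardo_energy_def using W_gagliardo_integrable[OF u] W_gagliardo_integrable[OF v] by simp
  finally show ?thesis .
qed

lemma emeasure_bounded_finite_lebesgue:
  fixes \<Omega> :: "'a::euclidean_space set"
  assumes "bounded \<Omega>" "open \<Omega>"
  shows "emeasure lebesgue \<Omega> < \<infinity>"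
  using emeasure_bounded_finite[OF assms(1)] assms(2) by simp

lemma W_set_integrable:
  assumes p: "1 < p" and \<Omega>: "open \<Omega>" "bounded \<Omega>" and u: "u \<in> W s p \<Omega>"
  shows "set_integrable lebesgue \<Omega> u"
proof (rule set_integrable_bound)
  note [measurable] = W_measurable[OF u]
  have [measurable]: "\<Omega> \<in> sets lebesgue" using \<Omega> by simp
  show "set_borel_measurable lebesgue \<Omega> u" unfolding set_borel_measurable_def by measurable
  have "set_integrable lebesgue \<Omega> (\<lambda>x. 1 :: real)"
    using emeasure_bounded_finite_lebesgue[OF \<Omega>(2,1)] by (simp add: set_integrable_def)
  then show "set_integrable lebesgue \<Omega> (\<lambda>x. 1 + \<bar>u x\<bar> powr p)"
    using W_powr_integrable[OF u] by (rule set_integral_add)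
  show "AE x in lebesgue. x \<in> \<Omega> \<longrightarrow> norm (u x) \<le> norm (1 + \<bar>u x\<bar> powr p)"
    using abs_le_add_powr[OF p, of 1] by (intro AE_I2) simp
qed

text \<open>
  A test function approximates itself; the content is that its norm is finite.
\<close>

lemma test_functions_subset_W0:
  fixes \<Omega> :: "'a::euclidean_space set"
  assumes sp: "0 < s" "s < 1" "1 < p" and \<Omega>: "open \<Omega>" "bounded \<Omega>"
  shows "test_functions \<Omega> \<subseteq> W0 s p \<Omega>"
proof
  fix f assume f: "f \<in> test_functions \<Omega>"
  have "f \<in> borel_measurable borel"
    using f by (intro borel_measurable_continuous_onI test_functions_continuous)
  then have m [measurable]: "f \<in> borel_measurable lebesgue"
    by (intro measurable_completion) simp
  obtain M where M: "0 \<le> M" "\<And>x. \<bar>f x\<bar> \<le> M" using test_functions_bounded[OF f] by metis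
  have "set_integrable lebesgue \<Omega> (\<lambda>x. \<bar>f x\<bar> powr p)"
    unfolding set_integrable_def
  proof (rule integrableI_bounded_set_indicator[where B = "M powr p"])
    show "\<Omega> \<in> sets lebesgue" using \<Omega> by simp
    show "emeasure lebesgue \<Omega> < \<infinity>" using \<Omega> by (intro emeasure_bounded_finite_lebesgue)
    show "AE x in lebesgue. x \<in> \<Omega> \<longrightarrow> norm (\<bar>f x\<bar> powr p) \<le> M powr p"
      using M sp by (intro AE_I2) (auto intro: powr_mono2)
  qed measurable
  then have "f \<in> W s p \<Omega>"
    using m test_functions_eq_0[OF f] test_functions_gagliardo_integrable[OF sp f] by (simp add: W_def)
  moreover have "gagliardo s p (\<lambda>x. f x - f x) + L_norm \<Omega> p (\<lambda>x. f x - f x) = 0"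
    using sp by (simp add: gagliardo_def gagliardo_integrand_def[abs_def] case_prod_unfold L_norm_def)
  ultimately show "f \<in> W0 s p \<Omega>" using f unfolding W0_def by force
qed

lemma W0_approx:
  assumes p: "1 < p" and \<eta>: "0 < \<eta>" and v: "v \<in> W0 s p \<Omega>"
  obtains f where "f \<in> test_functions \<Omega>" "gagliardo_energy s p (\<lambda>x. v x - f x) \<le> \<eta>"
    "(LINT x:\<Omega>|lebesgue. \<bar>v x - f x\<bar> powr p) \<le> \<eta>"
proof -
  have "0 < \<eta> powr (1 / p)" using \<eta> by simp
  then obtain f where f: "f \<in> test_functions \<Omega>"
    and fe: "gagliardo s p (\<lambda>x. v x - f x) + L_norm \<Omega> p (\<lambda>x. v x - f x) < \<eta> powr (1 / p)"
    using v unfolding W0_def by blast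
  have root: "a \<le> \<eta>" if "0 \<le> a" "a powr (1 / p) < \<eta> powr (1 / p)" for a
    using that \<eta> p powr_less_cancel2[of "1 / p" a \<eta>] by force
  have nn: "0 \<le> gagliardo s p (\<lambda>x. v x - f x)" "0 \<le> L_norm \<Omega> p (\<lambda>x. v x - f x)"
    by (simp_all add: gagliardo_def L_norm_def)
  have "gagliardo_energy s p (\<lambda>x. v x - f x) \<le> \<eta>"
    using nn fe by (intro root gagliardo_energy_nonneg) (simp add: gagliardo_def gagliardo_energy_def)
  moreover have "(LINT x:\<Omega>|lebesgue. \<bar>v x - f x\<bar> powr p) \<le> \<eta>"
  proof (rule root)
    show "0 \<le> (LINT x:\<Omega>|lebesgue. \<bar>v x - f x\<bar> powr p)" by (simp add: set_lebesgue_integral_def)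
    show "(LINT x:\<Omega>|lebesgue. \<bar>v x - f x\<bar> powr p) powr (1 / p) < \<eta> powr (1 / p)"
      using nn fe by (simp add: L_norm_def)
  qed
  ultimately show ?thesis using f that by blast
qed

section \<open>The fractional p-Laplacian form\<close>

definition frac_p_laplacian_integrand ::
  "real \<Rightarrow> real \<Rightarrow> ('a::euclidean_space \<Rightarrow> real) \<Rightarrow> ('a \<Rightarrow> real) \<Rightarrow> 'a \<times> 'a \<Rightarrow> real" where
  "frac_p_laplacian_integrand s p u v =
     (\<lambda>(x, y). \<bar>u x - u y\<bar> powr (p - 2) * (u x - u y) * (v x - v y)
        / norm (x - y) powr (real DIM('a) + s * p))"

lemma frac_p_laplacian_eq:
  "frac_p_laplacian s p u v = integral\<^sup>L (lebesgue \<Otimes>\<^sub>M lebesgue) (frac_p_laplacian_integrand s p u v)"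
  by (simp add: frac_p_laplacian_def frac_p_laplacian_integrand_def)

lemma frac_p_laplacian_self: "frac_p_laplacian s p u u = gagliardo_energy s p u"
  by (simp add: frac_p_laplacian_def gagliardo_energy_def gagliardo_integrand_def abs_powr_minus_two_mult)

lemma frac_p_laplacian_integrable:
  assumes p: "1 < p" and u: "u \<in> W s p \<Omega>" and v: "v \<in> W s p \<Omega>"
  shows "integrable (lebesgue \<Otimes>\<^sub>M lebesgue) (frac_p_laplacian_integrand s p u v)"
proof (rule Bochner_Integration.integrable_bound)
  note [measurable] = W_measurable[OF u] W_measurable[OF v]
  show "integrable (lebesgue \<Otimes>\<^sub>M lebesgue) (\<lambda>z. gagliardo_integrand s p u z + gagliardo_integrand s p v z)"
    using W_gagliardo_integrable[OF u] W_gagliardo_integrable[OF v] by simp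
  show "frac_p_laplacian_integrand s p u v \<in> borel_measurable (lebesgue \<Otimes>\<^sub>M lebesgue)"
    unfolding frac_p_laplacian_integrand_def case_prod_unfold by measurable
  have "norm (frac_p_laplacian_integrand s p u v (x, y))
      \<le> norm (gagliardo_integrand s p u (x, y) + gagliardo_integrand s p v (x, y))" for x y
    using divide_right_mono[OF abs_powr_young[OF p, of "u x - u y" "v x - v y"],
        of "norm (x - y) powr (real DIM('a) + s * p)"]
    by (simp add: frac_p_laplacian_integrand_def gagliardo_integrand_def add_divide_distrib)
  then show "AE z in lebesgue \<Otimes>\<^sub>M lebesgue. norm (frac_p_laplacian_integrand s p u v z)
      \<le> norm (gagliardo_integrand s p u z + gagliardo_integrand s p v z)"
    by (intro AE_I2) auto
qed

text \<open>
  Young's inequality for the increments of \<open>u\<close> and \<open>v\<close>, weighted by the kernel and integrated. In the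
  case of equality the nonnegative gap integrates to \<open>0\<close>, hence vanishes almost everywhere, and off
  the diagonal, where the weight is positive, the increments agree.
\<close>

lemma frac_p_laplacian_young:
  fixes u v :: "'a::euclidean_space \<Rightarrow> real"
  assumes p: "1 < p" and u: "u \<in> W s p \<Omega>" and v: "v \<in> W s p \<Omega>"
  shows "frac_p_laplacian s p u v \<le> (1 - 1 / p) * gagliardo_energy s p u + 1 / p * gagliardo_energy s p v"
    and "frac_p_laplacian s p u v = (1 - 1 / p) * gagliardo_energy s p u + 1 / p * gagliardo_energy s p v
      \<Longrightarrow> AE (x, y) in lebesgue \<Otimes>\<^sub>M lebesgue. u x - u y = v x - v y"
proof -
  define gap where "gap z = (1 - 1 / p) * gagliardo_integrand s p u z
    + 1 / p * gagliardo_integrand s p v z - frac_p_laplacian_integrand s p u v z" for z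
  have gap: "gap (x, y) = ((1 - 1 / p) * \<bar>u x - u y\<bar> powr p + 1 / p * \<bar>v x - v y\<bar> powr p
      - \<bar>u x - u y\<bar> powr (p - 2) * (u x - u y) * (v x - v y)) / norm (x - y) powr (real DIM('a) + s * p)" for x y
    by (simp add: gap_def gagliardo_integrand_def frac_p_laplacian_integrand_def
        add_divide_distrib diff_divide_distrib)
  have int: "integrable (lebesgue \<Otimes>\<^sub>M lebesgue) gap"
    unfolding gap_def[abs_def]
    using W_gagliardo_integrable[OF u] W_gagliardo_integrable[OF v] frac_p_laplacian_integrable[OF p u v] by simp
  have gap_int: "integral\<^sup>L (lebesgue \<Otimes>\<^sub>M lebesgue) gap = (1 - 1 / p) * gagliardo_energy s p u
      + 1 / p * gagliardo_energy s p v - frac_p_laplacian s p u v"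
    unfolding gap_def[abs_def] gagliardo_energy_def frac_p_laplacian_eq
    using W_gagliardo_integrable[OF u] W_gagliardo_integrable[OF v] frac_p_laplacian_integrable[OF p u v] by simp
  have nn: "0 \<le> gap z" for z
  proof (cases z)
    case (Pair x y)
    then show ?thesis using powr_young(1)[OF p, of "u x - u y" "v x - v y"] by (simp add: gap)
  qed
  then have "0 \<le> integral\<^sup>L (lebesgue \<Otimes>\<^sub>M lebesgue) gap" by simp
  then show "frac_p_laplacian s p u v \<le> (1 - 1 / p) * gagliardo_energy s p u + 1 / p * gagliardo_energy s p v"
    unfolding gap_int by simp
  assume "frac_p_laplacian s p u v = (1 - 1 / p) * gagliardo_energy s p u + 1 / p * gagliardo_energy s p v"
  then have "integral\<^sup>L (lebesgue \<Otimes>\<^sub>M lebesgue) gap = 0" unfolding gap_int by simp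
  then have "AE z in lebesgue \<Otimes>\<^sub>M lebesgue. gap z = 0"
    using integral_nonneg_eq_0_iff_AE[OF int] nn by simp
  moreover have "u x - u y = v x - v y" if "gap (x, y) = 0" for x y
  proof (cases "x = y")
    case False
    then have "\<bar>u x - u y\<bar> powr (p - 2) * (u x - u y) * (v x - v y)
        = (1 - 1 / p) * \<bar>u x - u y\<bar> powr p + 1 / p * \<bar>v x - v y\<bar> powr p"
      using that by (simp add: gap)
    then show ?thesis by (rule powr_young(2)[OF p])
  qed simp
  ultimately show "AE (x, y) in lebesgue \<Otimes>\<^sub>M lebesgue. u x - u y = v x - v y"
    by (auto elim!: eventually_mono)
qed

text \<open>
  A function of zero energy has almost everywhere zero increments. This shows that a torsion function with
  vanishing norm would force \<open>\<integral> v = 0\<close> for all \<open>v\<close>.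
\<close>

lemma frac_p_laplacian_eq_0:
  assumes u: "u \<in> W s p \<Omega>" and 0: "gagliardo_energy s p u = 0"
  shows "frac_p_laplacian s p u v = 0"
proof -
  have "AE z in lebesgue \<Otimes>\<^sub>M lebesgue. gagliardo_integrand s p u z = 0"
    using 0 integral_nonneg_eq_0_iff_AE[OF W_gagliardo_integrable[OF u]]
    by (simp add: gagliardo_energy_def gagliardo_integrand_nonneg)
  then have "AE z in lebesgue \<Otimes>\<^sub>M lebesgue. frac_p_laplacian_integrand s p u v z = 0"
    by eventually_elim (auto simp: gagliardo_integrand_def frac_p_laplacian_integrand_def)
  then show ?thesis unfolding frac_p_laplacian_eq by (rule integral_eq_zero_AE)
qed

text \<open>
  For almost every \<open>x\<close> the increments to almost every \<open>y\<close> agree. The complement of a bounded set is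
  not null, so one such \<open>y\<close> can be taken where both functions vanish.
\<close>

lemma eq_of_increments_eq:
  fixes u v :: "'a::euclidean_space \<Rightarrow> real"
  assumes \<Omega>: "bounded \<Omega>" "open \<Omega>" and u: "u \<in> W s p \<Omega>" and v: "v \<in> W s p \<Omega>"
    and inc: "AE (x, y) in lebesgue \<Otimes>\<^sub>M lebesgue. u x - u y = v x - v y"
  shows "AE x in lebesgue. u x = v x"
proof -
  have inc: "AE x in lebesgue. AE y in lebesgue. u x - u y = v x - v y"
    using lebesgue_pair.AE_pair[OF inc] by simp
  have "\<not> (AE y in lebesgue. y \<in> \<Omega>)"
  proof
    assume "AE y in lebesgue. y \<in> \<Omega>"
    then have "emeasure lebesgue (UNIV :: 'a set) \<le> emeasure lebesgue \<Omega>"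
      using \<Omega>(2) by (intro emeasure_mono_AE) auto
    then show False using emeasure_bounded_finite_lebesgue[OF \<Omega>] by simp
  qed
  note outside = this
  show ?thesis using inc
  proof eventually_elim
    fix x assume "AE y in lebesgue. u x - u y = v x - v y"
    with W_vanishes[OF u] W_vanishes[OF v]
    have "AE y in lebesgue. y \<notin> \<Omega> \<longrightarrow> u x = v x" by eventually_elim auto
    then show "u x = v x" using outside by (cases "u x = v x") (auto elim: eventually_mono)
  qed
qed

section \<open>The torsion function\<close>

lemma le_of_le_add_mult:
  fixes a b m :: real
  assumes "\<And>e. 0 < e \<Longrightarrow> a \<le> b + e * m"
  shows "a \<le> b"
proof (rule tendsto_lowerbound)
  show "((\<lambda>e. b + e * m) \<longlongrightarrow> b) (at_right 0)" by (auto intro!: tendsto_eq_intros)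
  show "\<forall>\<^sub>F e in at_right 0. a \<le> b + e * m"
    using assms by (auto simp: eventually_at_filter)
qed simp

text \<open>
  The weak equation is tested with the smoothed absolute value \<open>h\<close> of \<open>f\<close>, which is admissible, has at
  most the energy of \<open>f\<close>, and satisfies \<open>\<bar>f\<bar> \<le> h + e\<close>; then \<open>e\<close> tends to \<open>0\<close>.
\<close>

lemma torsion_test_function_bound:
  fixes \<Omega> :: "'a::euclidean_space set"
  assumes sp: "0 < s" "s < 1" "1 < p" and \<Omega>: "open \<Omega>" "bounded \<Omega>"
    and \<phi>: "is_torsion_function s p \<Omega> \<phi>" and f: "f \<in> test_functions \<Omega>"
  shows "(LINT x:\<Omega>|lebesgue. \<bar>f x\<bar>) \<le> (1 - 1 / p) * gagliardo_energy s p \<phi> + 1 / p * gagliardo_energy s p f"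
proof (rule le_of_le_add_mult)
  fix e :: real assume e: "0 < e"
  define h where "h x = sqrt ((f x)\<^sup>2 + e\<^sup>2) - e" for x
  have sub: "test_functions \<Omega> \<subseteq> W0 s p \<Omega>" using sp \<Omega> by (rule test_functions_subset_W0)
  have h: "h \<in> W0 s p \<Omega>" using sub test_functions_smooth_abs[OF f e] by (auto simp: h_def[abs_def])
  have fW: "f \<in> W s p \<Omega>" using sub f by (auto intro: W0_imp_W)
  have ih: "set_integrable lebesgue \<Omega> h" using sp \<Omega> h by (intro W_set_integrable W0_imp_W)
  have "set_integrable lebesgue \<Omega> f" using sp \<Omega> fW by (intro W_set_integrable)
  then have if': "set_integrable lebesgue \<Omega> (\<lambda>x. \<bar>f x\<bar>)" by (rule set_integrable_abs)
  have ie: "set_integrable lebesgue \<Omega> (\<lambda>x. e)"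
    using emeasure_bounded_finite_lebesgue[OF \<Omega>(2,1)] \<Omega>(1) by (simp add: set_integrable_def)
  have "\<bar>f x\<bar> \<le> h x + e" for x
    using real_sqrt_le_mono[of "(f x)\<^sup>2" "(f x)\<^sup>2 + e\<^sup>2"] by (simp add: h_def)
  then have "(LINT x:\<Omega>|lebesgue. \<bar>f x\<bar>) \<le> (LINT x:\<Omega>|lebesgue. h x + e)"
    by (intro set_integral_mono if' set_integral_add(1) ih ie)
  also have "\<dots> = (LINT x:\<Omega>|lebesgue. h x) + e * measure lebesgue \<Omega>"
    using set_integral_add(2)[OF ih ie] emeasure_bounded_finite_lebesgue[OF \<Omega>(2,1)] \<Omega>(1)
    by (simp add: set_integral_const)
  also have "(LINT x:\<Omega>|lebesgue. h x) = frac_p_laplacian s p \<phi> h"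
    using \<phi> h by (simp add: is_torsion_function_def)
  also have "\<dots> \<le> (1 - 1 / p) * gagliardo_energy s p \<phi> + 1 / p * gagliardo_energy s p h"
    using sp \<phi> h by (intro frac_p_laplacian_young(1) W0_imp_W) (auto simp: is_torsion_function_def)
  also have "gagliardo_energy s p h \<le> gagliardo_energy s p f"
    unfolding gagliardo_energy_def
  proof (intro integral_mono gagliardo_integrand_contraction
      W_gagliardo_integrable[OF fW] W_gagliardo_integrable[OF W0_imp_W[OF h]])
    show "\<bar>h x - h y\<bar> \<le> \<bar>f x - f y\<bar>" for x y
      using abs_sqrt_sum_squares_diff_le[of "f x" e "f y"] by (simp add: h_def)
  qed (use sp in auto)
  finally show "(LINT x:\<Omega>|lebesgue. \<bar>f x\<bar>) \<le> (1 - 1 / p) * gagliardo_energy s p \<phi>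
      + 1 / p * gagliardo_energy s p f + e * measure lebesgue \<Omega>"
    using sp by (simp add: divide_right_mono)
qed

text \<open>
  Density of test functions extends the bound to the whole space. The error \<open>v - f\<close> enters both
  sides, weighted by \<open>\<delta> powr (1 - p)\<close>, which blows up as \<open>\<delta>\<close> tends to \<open>0\<close>. Therefore the
  approximation is made exact first (\<open>\<eta>\<close> to \<open>0\<close> for fixed \<open>\<delta>\<close>), and only then \<open>\<delta>\<close> tends to \<open>0\<close>.
\<close>

lemma torsion_bound:
  fixes \<Omega> :: "'a::euclidean_space set"
  assumes sp: "0 < s" "s < 1" "1 < p" and \<Omega>: "open \<Omega>" "bounded \<Omega>"
    and \<phi>: "is_torsion_function s p \<Omega> \<phi>" and v: "v \<in> W0 s p \<Omega>"
  shows "(LINT x:\<Omega>|lebesgue. \<bar>v x\<bar>) \<le> (1 - 1 / p) * gagliardo_energy s p \<phi> + 1 / p * gagliardo_energy s p v"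
proof -
  let ?E = "gagliardo_energy s p"
  let ?I = "LINT x:\<Omega>|lebesgue. \<bar>v x\<bar>"
  define m where "m = measure lebesgue \<Omega>"
  define B where "B \<delta> = \<delta> * m + (1 - 1 / p) * ?E \<phi> + 1 / p * ((1 - \<delta>) powr (1 - p) * ?E v)" for \<delta>
  have vW: "v \<in> W s p \<Omega>" using v by (rule W0_imp_W)
  have B: "?I \<le> B \<delta>" if \<delta>: "0 < \<delta>" "\<delta> < 1" for \<delta>
  proof (rule le_of_le_add_mult)
    fix \<eta> :: real assume \<eta>: "0 < \<eta>"
    obtain f where f: "f \<in> test_functions \<Omega>" and fE: "?E (\<lambda>x. v x - f x) \<le> \<eta>"
      and fL: "(LINT x:\<Omega>|lebesgue. \<bar>v x - f x\<bar> powr p) \<le> \<eta>"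
      using W0_approx[OF sp(3) \<eta> v] by metis
    have fW: "f \<in> W s p \<Omega>" using f test_functions_subset_W0[OF sp \<Omega>] by (auto intro: W0_imp_W)
    have dW: "(\<lambda>x. v x - f x) \<in> W s p \<Omega>" by (rule W_diff[OF sp(3) \<Omega>(1) vW fW])
    have iv: "set_integrable lebesgue \<Omega> (\<lambda>x. \<bar>v x\<bar>)" and if': "set_integrable lebesgue \<Omega> (\<lambda>x. \<bar>f x\<bar>)"
      and id': "set_integrable lebesgue \<Omega> (\<lambda>x. \<bar>v x - f x\<bar>)"
      using W_set_integrable[OF sp(3) \<Omega> vW] W_set_integrable[OF sp(3) \<Omega> fW]
        W_set_integrable[OF sp(3) \<Omega> dW]
      by (simp_all only: set_integrable_abs)
    have i\<delta>: "set_integrable lebesgue \<Omega> (\<lambda>x. \<delta>)"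
      using emeasure_bounded_finite_lebesgue[OF \<Omega>(2,1)] \<Omega>(1) by (simp add: set_integrable_def)
    have ip: "set_integrable lebesgue \<Omega> (\<lambda>x. \<delta> powr (1 - p) * \<bar>v x - f x\<bar> powr p)"
      using W_powr_integrable[OF dW] by (rule set_integrable_mult_right)
    have "(LINT x:\<Omega>|lebesgue. \<bar>v x - f x\<bar>) \<le> (LINT x:\<Omega>|lebesgue. \<delta> + \<delta> powr (1 - p) * \<bar>v x - f x\<bar> powr p)"
      using abs_le_add_powr[OF sp(3) \<delta>(1)] by (intro set_integral_mono id' set_integral_add(1) i\<delta> ip)
    also have "\<dots> = \<delta> * m + \<delta> powr (1 - p) * (LINT x:\<Omega>|lebesgue. \<bar>v x - f x\<bar> powr p)"
      using set_integral_add(2)[OF i\<delta> ip] emeasure_bounded_finite_lebesgue[OF \<Omega>(2,1)] \<Omega>(1)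
      by (simp add: set_integral_const m_def)
    also have "\<dots> \<le> \<delta> * m + \<delta> powr (1 - p) * \<eta>" using fL by (intro add_left_mono mult_left_mono) auto
    finally have d: "(LINT x:\<Omega>|lebesgue. \<bar>v x - f x\<bar>) \<le> \<delta> * m + \<delta> powr (1 - p) * \<eta>" .
    have "?E f = ?E (\<lambda>x. v x + (-1) * (v x - f x))" by simp
    also have "\<dots> \<le> (1 - \<delta>) powr (1 - p) * ?E v + \<delta> powr (1 - p) * ?E (\<lambda>x. (-1) * (v x - f x))"
      by (rule gagliardo_energy_add_le[OF sp(3) \<delta> \<Omega>(1) vW W_cmult[OF dW]])
    also have "?E (\<lambda>x. (-1) * (v x - f x)) = ?E (\<lambda>x. v x - f x)"
      by (subst gagliardo_energy_cmult) simp
    also have "(1 - \<delta>) powr (1 - p) * ?E v + \<delta> powr (1 - p) * ?E (\<lambda>x. v x - f x)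
        \<le> (1 - \<delta>) powr (1 - p) * ?E v + \<delta> powr (1 - p) * \<eta>"
      using fE by (intro add_left_mono mult_left_mono) auto
    finally have Ef: "1 / p * ?E f \<le> 1 / p * ((1 - \<delta>) powr (1 - p) * ?E v + \<delta> powr (1 - p) * \<eta>)"
      using sp by (intro mult_left_mono) auto
    have "?I \<le> (LINT x:\<Omega>|lebesgue. \<bar>v x - f x\<bar> + \<bar>f x\<bar>)"
      by (intro set_integral_mono iv set_integral_add(1) id' if') auto
    also have "\<dots> = (LINT x:\<Omega>|lebesgue. \<bar>v x - f x\<bar>) + (LINT x:\<Omega>|lebesgue. \<bar>f x\<bar>)"
      by (rule set_integral_add(2)[OF id' if'])
    also have "\<dots> \<le> (\<delta> * m + \<delta> powr (1 - p) * \<eta>) + ((1 - 1 / p) * ?E \<phi>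
        + 1 / p * ((1 - \<delta>) powr (1 - p) * ?E v + \<delta> powr (1 - p) * \<eta>))"
      using d torsion_test_function_bound[OF sp \<Omega> \<phi> f] Ef by linarith
    also have "\<dots> = B \<delta> + \<eta> * (\<delta> powr (1 - p) * (1 + 1 / p))"
      by (simp add: B_def algebra_simps add_divide_distrib)
    finally show "?I \<le> B \<delta> + \<eta> * (\<delta> powr (1 - p) * (1 + 1 / p))" .
  qed
  show ?thesis
  proof (rule tendsto_lowerbound)
    show "(B \<longlongrightarrow> (1 - 1 / p) * ?E \<phi> + 1 / p * ?E v) (at_right 0)"
      using sp unfolding B_def by (auto intro!: tendsto_eq_intros)
    show "\<forall>\<^sub>F \<delta> in at_right 0. ?I \<le> B \<delta>"
      using B eventually_at_right_field[of _ "0::real"] by (metis zero_less_one)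
  qed simp
qed

text \<open>
  The bound for \<open>v = \<phi>\<close> absorbs the term \<open>(1 - 1/p) E \<phi>\<close> and gives \<open>\<integral> \<bar>\<phi>\<bar> \<le> E \<phi> = \<integral> \<phi>\<close>, which leaves
  no room for negative values. If \<open>\<phi>\<close> had norm \<open>0\<close>, the right side of the weak equation would vanish for
  every test function, in particular for a bump.
\<close>

lemma torsion_basic_properties:
  fixes \<Omega> :: "'a::euclidean_space set"
  assumes sp: "0 < s" "s < 1" "1 < p" and \<Omega>: "open \<Omega>" "bounded \<Omega>" "\<Omega> \<noteq> {}"
    and \<phi>: "is_torsion_function s p \<Omega> \<phi>"
  shows torsion_energy: "gagliardo_energy s p \<phi> = L_norm \<Omega> 1 \<phi>"
    and torsion_nonneg: "AE x in lebesgue. 0 \<le> \<phi> x"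
    and torsion_L1_norm_pos: "0 < L_norm \<Omega> 1 \<phi>"
proof -
  let ?T = "LINT x:\<Omega>|lebesgue. \<bar>\<phi> x\<bar>"
  have \<phi>0: "\<phi> \<in> W0 s p \<Omega>"
    and weak: "\<And>v. v \<in> W0 s p \<Omega> \<Longrightarrow> frac_p_laplacian s p \<phi> v = (LINT x:\<Omega>|lebesgue. v x)"
    using \<phi> by (auto simp: is_torsion_function_def)
  have \<phi>W: "\<phi> \<in> W s p \<Omega>" using \<phi>0 by (rule W0_imp_W)
  have i: "set_integrable lebesgue \<Omega> \<phi>" using sp \<Omega> \<phi>W by (intro W_set_integrable)
  have ia: "set_integrable lebesgue \<Omega> (\<lambda>x. \<bar>\<phi> x\<bar>)" using i by (rule set_integrable_abs)
  have E: "gagliardo_energy s p \<phi> = (LINT x:\<Omega>|lebesgue. \<phi> x)"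
    using weak[OF \<phi>0] by (simp add: frac_p_laplacian_self)
  have "?T \<le> gagliardo_energy s p \<phi>"
    using torsion_bound[OF sp \<Omega>(1,2) \<phi> \<phi>0] by (simp add: algebra_simps)
  moreover have "(LINT x:\<Omega>|lebesgue. \<phi> x) \<le> ?T"
    by (intro set_integral_mono i ia) auto
  ultimately have T: "gagliardo_energy s p \<phi> = ?T" using E by linarith
  then show "gagliardo_energy s p \<phi> = L_norm \<Omega> 1 \<phi>" by (simp add: L_norm_one)
  have "(LINT x:\<Omega>|lebesgue. \<bar>\<phi> x\<bar> - \<phi> x) = 0"
    using set_integral_diff(2)[OF ia i] E T by simp
  then have "AE x in lebesgue. indicator \<Omega> x *\<^sub>R (\<bar>\<phi> x\<bar> - \<phi> x) = 0"
    using set_integral_diff(1)[OF ia i] unfolding set_lebesgue_integral_def set_integrable_def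
    by (subst (asm) integral_nonneg_eq_0_iff_AE) (auto simp: indicator_def)
  with W_vanishes[OF \<phi>W] show "AE x in lebesgue. 0 \<le> \<phi> x"
    by eventually_elim (auto simp: indicator_def split: if_splits)
  show "0 < L_norm \<Omega> 1 \<phi>"
  proof (rule ccontr)
    assume "\<not> 0 < L_norm \<Omega> 1 \<phi>"
    then have "gagliardo_energy s p \<phi> = 0"
      using T gagliardo_energy_nonneg[of s p \<phi>] by (simp add: L_norm_one)
    then have zero: "(LINT x:\<Omega>|lebesgue. v x) = 0" if "v \<in> W0 s p \<Omega>" for v
      using weak[OF that] frac_p_laplacian_eq_0[OF \<phi>W] by simp
    obtain z where "z \<in> \<Omega>" using \<Omega>(3) by blast
    obtain f where f: "f \<in> test_functions \<Omega>" and f0: "\<And>x. 0 \<le> f x" "0 < f z"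
      using exists_bump_test_function[OF \<Omega>(1) \<open>z \<in> \<Omega>\<close>] by metis
    have fW: "f \<in> W0 s p \<Omega>" using f test_functions_subset_W0[OF sp \<Omega>(1,2)] by blast
    have "set_integrable lebesgue \<Omega> f" using sp \<Omega> fW by (intro W_set_integrable W0_imp_W)
    then have "AE x in lebesgue. indicator \<Omega> x *\<^sub>R f x = 0"
      using zero[OF fW] f0(1) unfolding set_lebesgue_integral_def set_integrable_def
      by (subst (asm) integral_nonneg_eq_0_iff_AE) (auto simp: indicator_def)
    then have ae: "AE x in lebesgue. x \<notin> {x. 0 < f x}"
      by eventually_elim (use test_functions_eq_0[OF f] in \<open>force simp: indicator_def split: if_splits\<close>)
    have op: "open {x. 0 < f x}"
      using test_functions_continuous[OF f] by (intro open_Collect_less) auto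
    then have "negligible {x. 0 < f x}"
      using ae by (simp add: negligible_iff_null_sets AE_iff_null_sets)
    then show False using open_not_negligible[OF op] f0(2) by blast
  qed
qed

text \<open>
  The bound is not homogeneous in \<open>v\<close>, so the multiple to which it is applied matters. It is sharp for
  \<open>\<phi>\<close>, hence the multiple \<open>T v\<close> that has the same norm as \<open>\<phi>\<close> is the right one.
\<close>

lemma torsion_energy_lower_bound:
  fixes \<Omega> :: "'a::euclidean_space set"
  assumes sp: "0 < s" "s < 1" "1 < p" and \<Omega>: "open \<Omega>" "bounded \<Omega>" "\<Omega> \<noteq> {}"
    and \<phi>: "is_torsion_function s p \<Omega> \<phi>" and v: "v \<in> W0 s p \<Omega>" "L_norm \<Omega> 1 v = 1"
  shows "1 / L_norm \<Omega> 1 \<phi> powr (p - 1) \<le> gagliardo_energy s p v"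
proof -
  let ?T = "L_norm \<Omega> 1 \<phi>"
  have T: "0 < ?T" using sp \<Omega> \<phi> by (rule torsion_L1_norm_pos)
  have "?T = L_norm \<Omega> 1 (\<lambda>x. ?T * v x)" using v(2) T by (simp add: L_norm_cmult)
  also have "\<dots> \<le> (1 - 1 / p) * gagliardo_energy s p \<phi> + 1 / p * gagliardo_energy s p (\<lambda>x. ?T * v x)"
    using torsion_bound[OF sp \<Omega>(1,2) \<phi> W0_cmult[OF _ v(1), of ?T]] sp by (simp add: L_norm_one)
  also have "\<dots> = ?T - 1 / p * ?T + 1 / p * (?T powr p * gagliardo_energy s p v)"
    using T torsion_energy[OF sp \<Omega> \<phi>] by (simp add: gagliardo_energy_cmult left_diff_distrib)
  finally have "1 / p * ?T \<le> 1 / p * (?T powr p * gagliardo_energy s p v)" by linarith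
  then have "?T \<le> ?T powr p * gagliardo_energy s p v" using sp by (simp add: divide_le_cancel)
  also have "?T powr p = ?T powr (p - 1) * ?T" using T by (simp add: powr_diff)
  finally have "1 \<le> ?T powr (p - 1) * gagliardo_energy s p v" using T by (simp add: mult.assoc)
  then show ?thesis using T by (simp add: field_simps)
qed

theorem theorem2p1:
  fixes \<Omega> :: "(real ^ 'n) set" and s p :: real and \<phi> :: "real ^ 'n \<Rightarrow> real"
  assumes "CARD('n) \<ge> 2"
    and "lipschitz_bounded_domain \<Omega>"
    and "0 < s" and "s < 1" and "1 < p" and "p < real CARD('n) / s"
    and "is_torsion_function s p \<Omega> \<phi>"
  shows "let w = (\<lambda>x. \<phi> x / L_norm \<Omega> 1 \<phi>);
             energy = (\<lambda>v. gagliardo s p v powr p);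
             admissible = (\<lambda>v. v \<in> W0 s p \<Omega> \<and> L_norm \<Omega> 1 v = 1)
         in 1 / L_norm \<Omega> 1 \<phi> powr (p - 1) = energy w \<and>
            is_arg_min energy admissible w \<and>
            (AE x in lebesgue. 0 \<le> w x) \<and>
            (\<forall>v. is_arg_min energy admissible v \<and> (AE x in lebesgue. 0 \<le> v x) \<longrightarrow>
                 (AE x in lebesgue. v x = w x))"
proof -
  note sp = \<open>0 < s\<close> \<open>s < 1\<close> \<open>1 < p\<close>
  have \<Omega>: "open \<Omega>" "bounded \<Omega>" "\<Omega> \<noteq> {}"
    using \<open>lipschitz_bounded_domain \<Omega>\<close> by (auto simp: lipschitz_bounded_domain_def)
  note \<phi> = \<open>is_torsion_function s p \<Omega> \<phi>\<close>
  have \<phi>0: "\<phi> \<in> W0 s p \<Omega>" using \<phi> by (simp add: is_torsion_function_def)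
  define T where "T = L_norm \<Omega> 1 \<phi>"
  define w where "w x = \<phi> x / T" for x
  define E where "E v = gagliardo_energy s p v" for v :: "real ^ 'n \<Rightarrow> real"
  have en: "gagliardo s p v powr p = E v" for v :: "real ^ 'n \<Rightarrow> real"
    using sp unfolding E_def by (intro gagliardo_powr) simp
  have T: "0 < T" unfolding T_def using sp \<Omega> \<phi> by (rule torsion_L1_norm_pos)
  have E\<phi>: "E \<phi> = T" unfolding E_def T_def using sp \<Omega> \<phi> by (rule torsion_energy)
  have w: "w = (\<lambda>x. 1 / T * \<phi> x)" by (simp add: w_def[abs_def])
  have Ew: "1 / T powr (p - 1) = E w"
  proof -
    have "E w = (1 / T) powr p * T"
      using T E\<phi> unfolding E_def w gagliardo_energy_cmult by simp
    also have "\<dots> = 1 / T powr (p - 1)" using T by (simp add: powr_divide powr_diff)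
    finally show ?thesis by simp
  qed
  have lower: "E w \<le> E v" if "v \<in> W0 s p \<Omega>" "L_norm \<Omega> 1 v = 1" for v
    using torsion_energy_lower_bound[OF sp \<Omega> \<phi> that] Ew by (simp add: E_def T_def)
  have adm: "w \<in> W0 s p \<Omega>" "L_norm \<Omega> 1 w = 1"
  proof -
    show "w \<in> W0 s p \<Omega>" unfolding w using sp \<phi>0 by (intro W0_cmult) auto
    show "L_norm \<Omega> 1 w = 1" unfolding w using T by (subst L_norm_cmult) (auto simp: T_def)
  qed
  have nonneg: "AE x in lebesgue. 0 \<le> w x"
    using torsion_nonneg[OF sp \<Omega> \<phi>] T by (auto simp: w_def elim!: eventually_mono)
  have unique: "AE x in lebesgue. v x = w x"
    if v: "v \<in> W0 s p \<Omega>" "L_norm \<Omega> 1 v = 1" and le: "E v \<le> E w" and pos: "AE x in lebesgue. 0 \<le> v x" for v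
  proof -
    \<comment> \<open>With this scaling \<open>z\<close> has the norm and the energy of \<open>\<phi>\<close>, and both sides of Young's inequality equal \<open>T\<close>.\<close>
    define z where "z x = T * v x" for x
    have z0: "z \<in> W0 s p \<Omega>" unfolding z_def[abs_def] using sp v by (intro W0_cmult) auto
    have "E z = T powr p * E v" using T by (simp add: E_def z_def[abs_def] gagliardo_energy_cmult)
    also have "E v = 1 / T powr (p - 1)" using lower[OF v] le Ew by simp
    also have "T powr p * (1 / T powr (p - 1)) = T" using T by (simp add: powr_diff)
    finally have Ez: "E z = T" .
    have "frac_p_laplacian s p \<phi> z = (LINT x:\<Omega>|lebesgue. z x)"
      using \<phi> z0 by (simp add: is_torsion_function_def)
    also have "\<dots> = T * (LINT x:\<Omega>|lebesgue. v x)" by (simp add: z_def)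
    also have "(LINT x:\<Omega>|lebesgue. v x) = (LINT x:\<Omega>|lebesgue. \<bar>v x\<bar>)"
      unfolding set_lebesgue_integral_def
    proof (rule integral_cong_AE)
      have [measurable]: "v \<in> borel_measurable lebesgue" using v by (intro W_measurable W0_imp_W)
      have [measurable]: "\<Omega> \<in> sets lebesgue" using \<Omega> by simp
      show "(\<lambda>x. indicator \<Omega> x *\<^sub>R v x) \<in> borel_measurable lebesgue" by measurable
      show "(\<lambda>x. indicator \<Omega> x *\<^sub>R \<bar>v x\<bar>) \<in> borel_measurable lebesgue" by measurable
      show "AE x in lebesgue. indicator \<Omega> x *\<^sub>R v x = indicator \<Omega> x *\<^sub>R \<bar>v x\<bar>"
        using pos by eventually_elim simp
    qed
    also have "\<dots> = 1" using v(2) by (simp add: L_norm_one)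
    finally have "frac_p_laplacian s p \<phi> z
        = (1 - 1 / p) * gagliardo_energy s p \<phi> + 1 / p * gagliardo_energy s p z"
      using E\<phi> Ez by (simp add: E_def algebra_simps)
    then have "AE (x, y) in lebesgue \<Otimes>\<^sub>M lebesgue. \<phi> x - \<phi> y = z x - z y"
      by (rule frac_p_laplacian_young(2)[OF sp(3) W0_imp_W[OF \<phi>0] W0_imp_W[OF z0]])
    then have "AE x in lebesgue. \<phi> x = z x"
      by (rule eq_of_increments_eq[OF \<Omega>(2,1) W0_imp_W[OF \<phi>0] W0_imp_W[OF z0]])
    then show ?thesis using T by (auto simp: w_def z_def elim!: eventually_mono)
  qed
  have "is_arg_min E (\<lambda>v. v \<in> W0 s p \<Omega> \<and> L_norm \<Omega> 1 v = 1) w"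
    using adm lower by (force simp: is_arg_min_def)
  moreover have "AE x in lebesgue. v x = w x"
    if "is_arg_min E (\<lambda>v. v \<in> W0 s p \<Omega> \<and> L_norm \<Omega> 1 v = 1) v" "AE x in lebesgue. 0 \<le> v x" for v
  proof (rule unique)
    show "E v \<le> E w" using that(1) adm unfolding is_arg_min_def by force
  qed (use that in \<open>auto simp: is_arg_min_def\<close>)
  ultimately show ?thesis
    using Ew nonneg unfolding Let_def en T_def[symmetric] w_def[symmetric, abs_def]
    by (intro conjI allI impI) auto
qed

end
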